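(* Let $m,n\ge 2$ be integers. There exists a quasiisometric embedding $BS(1,m)\to BS(1,n)$ if and only if $m,n$ are powers of a common integer.
   Context: $BS(1,m)=\langle a,t\mid tat^{-1}=a^m\rangle$ is the solvable Baumslag--Solitar group, equipped with the word metric of some finite generating set. A quasiisometric embedding between metric spaces $X,Y$ is a map $f:X\to Y$ for which there are $K\ge1$, $C\ge0$ with $\frac1K d(x,x')-C\le d(f(x),f(x'))\le K d(x,x')+C$ for all $x,x'\in X$. The integers $m,n$ are powers of a common integer if there are positive integers $r,s,t$ with $m=r^s$ and $n=r^t$. *)

theory Defs
  imports "HOL-Algebra.Generated_Groups" "HOL-Analysis.Abstract_Metric_Spaces"
begin

text \<open>A letter \<open>(x, False)\<close> stands for the generator \<open>x\<close> and \<open>(x, True)\<close> for its formal inverse.\<close>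

type_synonym 'g word = "('g \<times> bool) list"

definition word_inv :: "'g word \<Rightarrow> 'g word" where
  "word_inv w = rev (map (\<lambda>(x, b). (x, \<not> b)) w)"

inductive pres_eq :: "'g word set \<Rightarrow> 'g word \<Rightarrow> 'g word \<Rightarrow> bool" for R where
  refl: "pres_eq R u u"
| sym: "pres_eq R u v \<Longrightarrow> pres_eq R v u"
| trans: "pres_eq R u v \<Longrightarrow> pres_eq R v w \<Longrightarrow> pres_eq R u w"
| cancel: "pres_eq R (u @ [(x, b), (x, \<not> b)] @ v) (u @ v)"
| relator: "r \<in> R \<Longrightarrow> pres_eq R (u @ r @ v) (u @ v)"

definition word_class :: "'g word set \<Rightarrow> 'g word \<Rightarrow> 'g word set" where
  "word_class R w = {v. pres_eq R w v}"

text \<open>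
  The generators of the presented group are all elements of the type \<open>'g\<close>.
\<close>

definition presented_group :: "'g word set \<Rightarrow> 'g word set monoid" where
  "presented_group R =
    \<lparr>carrier = range (word_class R),
     mult = (\<lambda>X Y. \<Union>u\<in>X. \<Union>v\<in>Y. word_class R (u @ v)),
     one = word_class R []\<rparr>"

lemma pres_eq_context: "pres_eq R u v \<Longrightarrow> pres_eq R (p @ u @ q) (p @ v @ q)"
proof (induction rule: pres_eq.induct)
  case (cancel u x b v)
  then show ?case using pres_eq.cancel[of R "p @ u" x b "v @ q"] by simp
next
  case (relator r u v)
  then show ?case using pres_eq.relator[of r R "p @ u" "v @ q"] by simp
next
  case (sym u v)
  show ?case by (rule pres_eq.sym[OF sym.IH])
next
  case (trans u v w)
  show ?case by (rule pres_eq.trans[OF trans.IH])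
qed (rule pres_eq.refl)

lemma pres_eq_append:
  assumes "pres_eq R u u'" "pres_eq R v v'"
  shows "pres_eq R (u @ v) (u' @ v')"
proof (rule pres_eq.trans)
  show "pres_eq R (u @ v) (u' @ v)" using pres_eq_context[OF assms(1), of "[]" v] by simp
  show "pres_eq R (u' @ v) (u' @ v')" using pres_eq_context[OF assms(2), of u' "[]"] by simp
qed

lemma word_class_eq_iff: "word_class R u = word_class R v \<longleftrightarrow> pres_eq R u v"
proof
  assume "word_class R u = word_class R v"
  then have "v \<in> word_class R u" by (simp add: word_class_def pres_eq.refl)
  then show "pres_eq R u v" by (simp add: word_class_def)
next
  assume uv: "pres_eq R u v"
  show "word_class R u = word_class R v"
    unfolding word_class_def
    using pres_eq.trans[OF uv] pres_eq.trans[OF pres_eq.sym[OF uv]] by blast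
qed

lemma pres_eq_word_inv_right: "pres_eq R (w @ word_inv w) []"
proof (induction w)
  case Nil
  then show ?case by (simp add: word_inv_def pres_eq.refl)
next
  case (Cons l w)
  obtain x b where l: "l = (x, b)" by (cases l)
  have "pres_eq R ([l] @ (w @ word_inv w) @ [(x, \<not> b)]) ([l] @ [] @ [(x, \<not> b)])"
    by (rule pres_eq_context[OF Cons.IH])
  moreover have "pres_eq R ([l] @ [] @ [(x, \<not> b)]) []"
    using pres_eq.cancel[of R "[]" x b "[]"] l by simp
  ultimately have "pres_eq R ([l] @ (w @ word_inv w) @ [(x, \<not> b)]) []"
    by (rule pres_eq.trans)
  then show ?case by (simp add: l word_inv_def)
qed

lemma word_inv_word_inv [simp]: "word_inv (word_inv w) = w"
  by (induction w) (auto simp: word_inv_def)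

lemma pres_eq_word_inv_left: "pres_eq R (word_inv w @ w) []"
  using pres_eq_word_inv_right[of R "word_inv w"] by simp

lemma carrier_presented_group: "carrier (presented_group R) = range (word_class R)"
  and one_presented_group: "\<one>\<^bsub>presented_group R\<^esub> = word_class R []"
  by (simp_all add: presented_group_def)

lemma mult_word_class:
  "word_class R u \<otimes>\<^bsub>presented_group R\<^esub> word_class R v = word_class R (u @ v)"
proof -
  let ?U = "word_class R u" and ?V = "word_class R v"
  have const: "word_class R (u' @ v') = word_class R (u @ v)" if "u' \<in> ?U" "v' \<in> ?V" for u' v'
  proof -
    have "pres_eq R (u @ v) (u' @ v')"
      using that by (intro pres_eq_append) (simp_all add: word_class_def)
    then show ?thesis by (simp only: word_class_eq_iff pres_eq.sym)
  qed
  have "u \<in> ?U" "v \<in> ?V" by (simp_all add: word_class_def pres_eq.refl)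
  then have "?U \<noteq> {}" "?V \<noteq> {}" by blast+
  moreover have "(\<Union>u'\<in>?U. \<Union>v'\<in>?V. word_class R (u' @ v')) = (\<Union>u'\<in>?U. \<Union>v'\<in>?V. word_class R (u @ v))"
    by (intro SUP_cong const) (rule HOL.refl | assumption)+
  ultimately show ?thesis by (simp add: presented_group_def)
qed

lemma group_presented_group: "group (presented_group R)"
proof (rule groupI)
  fix x assume "x \<in> carrier (presented_group R)"
  then obtain u where "x = word_class R u" by (auto simp: carrier_presented_group)
  then have "word_class R (word_inv u) \<otimes>\<^bsub>presented_group R\<^esub> x = \<one>\<^bsub>presented_group R\<^esub>"
    by (simp add: mult_word_class one_presented_group word_class_eq_iff pres_eq_word_inv_left)
  then show "\<exists>y\<in>carrier (presented_group R). y \<otimes>\<^bsub>presented_group R\<^esub> x = \<one>\<^bsub>presented_group R\<^esub>"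
    by (auto simp: carrier_presented_group)
qed (auto simp: carrier_presented_group one_presented_group mult_word_class)

lemma inv_word_class:
  "inv\<^bsub>presented_group R\<^esub> (word_class R u) = word_class R (word_inv u)"
  by (rule group.inv_equality[OF group_presented_group])
    (auto simp: carrier_presented_group mult_word_class one_presented_group
      word_class_eq_iff pres_eq_word_inv_left)

datatype bs_gen = Gen_a | Gen_t

text \<open>The relation \<open>t a t\<^sup>-\<^sup>1 = a\<^sup>m\<close> as the relator \<open>t a t\<^sup>-\<^sup>1 a\<^sup>-\<^sup>m\<close>.\<close>

definition BS_relator :: "nat \<Rightarrow> bs_gen word" where
  "BS_relator m =
    [(Gen_t, False), (Gen_a, False), (Gen_t, True)] @ replicate m (Gen_a, True)"

definition BS :: "nat \<Rightarrow> bs_gen word set monoid" where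
  "BS m = presented_group {BS_relator m}"

definition BS_gen :: "nat \<Rightarrow> bs_gen \<Rightarrow> bs_gen word set" where
  "BS_gen m x = word_class {BS_relator m} [(x, False)]"

lemma group_BS: "group (BS m)"
  by (simp add: BS_def group_presented_group)

lemma BS_gen_closed: "BS_gen m x \<in> carrier (BS m)"
  by (simp add: BS_gen_def BS_def carrier_presented_group)

lemma BS_gen_pow:
  "BS_gen m x [^]\<^bsub>BS m\<^esub> k = word_class {BS_relator m} (replicate k (x, False))"
proof (induction k)
  case 0
  show ?case by (simp add: nat_pow_def BS_def one_presented_group)
next
  case (Suc k)
  have "BS_gen m x [^]\<^bsub>BS m\<^esub> Suc k =
      (BS_gen m x [^]\<^bsub>BS m\<^esub> k) \<otimes>\<^bsub>BS m\<^esub> BS_gen m x"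
    by (simp add: nat_pow_def)
  also have "\<dots> = word_class {BS_relator m} (replicate k (x, False) @ [(x, False)])"
    unfolding Suc.IH unfolding BS_gen_def BS_def mult_word_class ..
  finally show ?case by (simp only: replicate_append_same replicate_Suc)
qed

lemma BS_relation:
  "BS_gen m Gen_t \<otimes>\<^bsub>BS m\<^esub> BS_gen m Gen_a \<otimes>\<^bsub>BS m\<^esub> inv\<^bsub>BS m\<^esub> BS_gen m Gen_t =
    BS_gen m Gen_a [^]\<^bsub>BS m\<^esub> m"
proof -
  let ?R = "{BS_relator m}"
  let ?p = "replicate m (Gen_a, False)"
  let ?w = "[(Gen_t, False), (Gen_a, False), (Gen_t, True)]"
  have inv: "word_inv ?p = replicate m (Gen_a, True)"
    by (simp add: word_inv_def rev_replicate)
  have 1: "pres_eq ?R (?w @ word_inv ?p @ ?p) ?w"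
    using pres_eq_context[OF pres_eq_word_inv_left[of ?R ?p], of ?w "[]"] by simp
  have 2: "pres_eq ?R (?w @ word_inv ?p @ ?p) ?p"
    using pres_eq.relator[of "BS_relator m" ?R "[]" ?p]
    by (simp add: inv BS_relator_def)
  have "pres_eq ?R ?w ?p"
    by (rule pres_eq.trans[OF pres_eq.sym[OF 1] 2])
  then have "word_class ?R ?w = word_class ?R ?p"
    by (simp only: word_class_eq_iff)
  then show ?thesis
    unfolding BS_gen_pow
    unfolding BS_gen_def BS_def inv_word_class mult_word_class
    by (simp add: word_inv_def)
qed

lemma word_class_in_generate:
  "word_class {BS_relator m} w \<in> generate (BS m) (range (BS_gen m))"
proof (induction w)
  case Nil
  show ?case
    using generate.one[of "BS m" "range (BS_gen m)"]
    unfolding BS_def one_presented_group .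
next
  case (Cons l w)
  obtain x b where l: "l = (x, b)" by (cases l)
  have "word_class {BS_relator m} [l] \<in> generate (BS m) (range (BS_gen m))"
  proof (cases b)
    case True
    have "inv\<^bsub>BS m\<^esub> BS_gen m x = word_class {BS_relator m} [l]"
      unfolding BS_gen_def BS_def inv_word_class by (simp add: l True word_inv_def)
    then show ?thesis
      using generate.inv[OF rangeI, of "BS m" "BS_gen m" x] by (simp only:)
  next
    case False
    have "BS_gen m x = word_class {BS_relator m} [l]"
      unfolding BS_gen_def by (simp add: l False)
    then show ?thesis
      using generate.incl[OF rangeI, of "BS_gen m" x "BS m"] by (simp only:)
  qed
  from generate.eng[OF this Cons.IH] show ?case
    unfolding BS_def mult_word_class by simp
qed

definition finite_generating_set :: "('a, 'b) monoid_scheme \<Rightarrow> 'a set \<Rightarrow> bool" where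
  "finite_generating_set G S \<longleftrightarrow>
    finite S \<and> S \<subseteq> carrier G \<and> generate G S = carrier G"

definition word_length :: "('a, 'b) monoid_scheme \<Rightarrow> 'a set \<Rightarrow> 'a \<Rightarrow> nat" where
  "word_length G S g =
    (LEAST k. \<exists>xs. length xs = k \<and> set xs \<subseteq> S \<union> m_inv G ` S \<and>
       foldr (mult G) xs \<one>\<^bsub>G\<^esub> = g)"

text \<open>
  The value outside the carrier is irrelevant; it is fixed only because \<open>Metric_space\<close> requires
  nonnegativity and symmetry on the whole type.
\<close>

definition word_dist :: "('a, 'b) monoid_scheme \<Rightarrow> 'a set \<Rightarrow> 'a \<Rightarrow> 'a \<Rightarrow> real" where
  "word_dist G S g h =
    (if g \<in> carrier G \<and> h \<in> carrier G
     then real (word_length G S (inv\<^bsub>G\<^esub> g \<otimes>\<^bsub>G\<^esub> h)) else 0)"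

lemma finite_generating_set_BS: "finite_generating_set (BS m) {BS_gen m Gen_a, BS_gen m Gen_t}"
proof -
  have univ: "(UNIV :: bs_gen set) = {Gen_a, Gen_t}"
    using bs_gen.exhaust by blast
  have range: "range (BS_gen m) = {BS_gen m Gen_a, BS_gen m Gen_t}"
    by (subst univ) (simp only: image_insert image_empty)
  have sub: "range (BS_gen m) \<subseteq> carrier (BS m)"
    using BS_gen_closed by blast
  have "carrier (BS m) \<subseteq> generate (BS m) (range (BS_gen m))"
    using word_class_in_generate unfolding BS_def carrier_presented_group by blast
  with group.generate_incl[OF group_BS sub]
  have "generate (BS m) (range (BS_gen m)) = carrier (BS m)" by (rule equalityI)
  with sub show ?thesis unfolding finite_generating_set_def range by blast
qed

context group begin

lemma foldr_mult_closed:
  "set xs \<subseteq> carrier G \<Longrightarrow> foldr (\<otimes>) xs \<one> \<in> carrier G"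
  by (induction xs) auto

lemma foldr_mult_append:
  "set xs \<subseteq> carrier G \<Longrightarrow> set ys \<subseteq> carrier G \<Longrightarrow>
    foldr (\<otimes>) (xs @ ys) \<one> = foldr (\<otimes>) xs \<one> \<otimes> foldr (\<otimes>) ys \<one>"
  by (induction xs) (auto simp: m_assoc foldr_mult_closed)

lemma foldr_mult_inv:
  "set xs \<subseteq> carrier G \<Longrightarrow>
    foldr (\<otimes>) (rev (map (m_inv G) xs)) \<one> = inv (foldr (\<otimes>) xs \<one>)"
proof (induction xs)
  case (Cons x xs)
  then have "set (rev (map (m_inv G) xs)) \<subseteq> carrier G" by auto
  with Cons show ?case
    by (simp add: foldr_mult_append inv_mult_group foldr_mult_closed del: foldr_append)
qed auto

lemma generate_foldr:
  assumes "S \<subseteq> carrier G" "g \<in> generate G S"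
  shows "\<exists>xs. set xs \<subseteq> S \<union> m_inv G ` S \<and> foldr (\<otimes>) xs \<one> = g"
  using assms(2)
proof (induction rule: generate.induct)
  case one
  then show ?case by (intro exI[of _ "[]"]) auto
next
  case (incl h)
  then show ?case using assms(1) by (intro exI[of _ "[h]"]) auto
next
  case (inv h)
  then show ?case using assms(1) by (intro exI[of _ "[inv h]"]) auto
next
  case (eng h1 h2)
  then obtain xs ys where
    "set xs \<subseteq> S \<union> m_inv G ` S" "foldr (\<otimes>) xs \<one> = h1"
    "set ys \<subseteq> S \<union> m_inv G ` S" "foldr (\<otimes>) ys \<one> = h2" by blast
  moreover have "S \<union> m_inv G ` S \<subseteq> carrier G" using assms(1) by auto
  ultimately show ?case
    by (intro exI[of _ "xs @ ys"]) (use foldr_mult_append[of xs ys] in auto)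
qed

lemma word_length_witness:
  assumes "finite_generating_set G S" "g \<in> carrier G"
  shows "\<exists>xs. length xs = word_length G S g \<and> set xs \<subseteq> S \<union> m_inv G ` S \<and>
    foldr (\<otimes>) xs \<one> = g"
proof -
  have "\<exists>k xs. length xs = k \<and> set xs \<subseteq> S \<union> m_inv G ` S \<and> foldr (\<otimes>) xs \<one> = g"
    using generate_foldr[of S g] assms by (auto simp: finite_generating_set_def)
  then show ?thesis unfolding word_length_def by (rule LeastI_ex)
qed

lemma word_length_le:
  assumes "set xs \<subseteq> S \<union> m_inv G ` S"
  shows "word_length G S (foldr (\<otimes>) xs \<one>) \<le> length xs"
  unfolding word_length_def by (rule Least_le) (use assms in blast)

lemma word_length_inv_le:
  assumes S: "finite_generating_set G S" and g: "g \<in> carrier G"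
  shows "word_length G S (inv g) \<le> word_length G S g"
proof -
  obtain xs where xs: "length xs = word_length G S g" "set xs \<subseteq> S \<union> m_inv G ` S"
    "foldr (\<otimes>) xs \<one> = g" using word_length_witness[OF assms] by blast
  have SG: "S \<subseteq> carrier G" using S by (simp add: finite_generating_set_def)
  have "set xs \<subseteq> carrier G" using xs(2) SG by auto
  moreover have "set (rev (map (m_inv G) xs)) \<subseteq> S \<union> m_inv G ` S"
    using xs(2) SG by fastforce
  ultimately show ?thesis
    using word_length_le[of "rev (map (m_inv G) xs)" S] foldr_mult_inv[of xs] xs by simp
qed

lemma word_length_mult_le:
  assumes S: "finite_generating_set G S" and gh: "g \<in> carrier G" "h \<in> carrier G"
  shows "word_length G S (g \<otimes> h) \<le> word_length G S g + word_length G S h"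
proof -
  obtain xs where xs: "length xs = word_length G S g" "set xs \<subseteq> S \<union> m_inv G ` S"
    "foldr (\<otimes>) xs \<one> = g" using word_length_witness[OF S gh(1)] by blast
  obtain ys where ys: "length ys = word_length G S h" "set ys \<subseteq> S \<union> m_inv G ` S"
    "foldr (\<otimes>) ys \<one> = h" using word_length_witness[OF S gh(2)] by blast
  have "S \<union> m_inv G ` S \<subseteq> carrier G" using S by (auto simp: finite_generating_set_def)
  then have "foldr (\<otimes>) (xs @ ys) \<one> = g \<otimes> h"
    using foldr_mult_append[of xs ys] xs ys by blast
  then show ?thesis using word_length_le[of "xs @ ys" S] xs ys by simp
qed

lemma word_length_eq_0_iff:
  assumes S: "finite_generating_set G S" and g: "g \<in> carrier G"
  shows "word_length G S g = 0 \<longleftrightarrow> g = \<one>"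
  using word_length_witness[OF assms] word_length_le[of "[]" S] by auto

lemma Metric_space_word_dist:
  assumes S: "finite_generating_set G S"
  shows "Metric_space (carrier G) (word_dist G S)"
proof
  fix x y
  show "0 \<le> word_dist G S x y" by (simp add: word_dist_def)
  have le: "word_dist G S x y \<le> word_dist G S y x"
    if "x \<in> carrier G" "y \<in> carrier G" for x y
    using word_length_inv_le[OF S, of "inv y \<otimes> x"] that
    by (simp add: word_dist_def inv_mult_group)
  show "word_dist G S x y = word_dist G S y x"
  proof (cases "x \<in> carrier G \<and> y \<in> carrier G")
    case True
    then show ?thesis using le[of x y] le[of y x] by simp
  qed (auto simp: word_dist_def)
next
  fix x y assume "x \<in> carrier G" "y \<in> carrier G"
  moreover from this have "inv x \<otimes> y = \<one> \<longleftrightarrow> x = y"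
    by (metis inv_closed inv_equality inv_inv l_inv)
  ultimately show "word_dist G S x y = 0 \<longleftrightarrow> x = y"
    by (simp add: word_dist_def word_length_eq_0_iff[OF S])
next
  fix x y z assume xyz: "x \<in> carrier G" "y \<in> carrier G" "z \<in> carrier G"
  then have "(inv x \<otimes> y) \<otimes> (inv y \<otimes> z) = inv x \<otimes> z"
    by (simp add: m_assoc[symmetric]) (simp add: m_assoc)
  then show "word_dist G S x z \<le> word_dist G S x y + word_dist G S y z"
    using word_length_mult_le[OF S, of "inv x \<otimes> y" "inv y \<otimes> z"] xyz
    by (simp add: word_dist_def)
qed

end

definition quasiisometric_embedding ::
    "'a set \<Rightarrow> ('a \<Rightarrow> 'a \<Rightarrow> real) \<Rightarrow> 'b set \<Rightarrow> ('b \<Rightarrow> 'b \<Rightarrow> real) \<Rightarrow> ('a \<Rightarrow> 'b) \<Rightarrow> bool" where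
  "quasiisometric_embedding X dX Y dY f \<longleftrightarrow>
    f ` X \<subseteq> Y \<and>
    (\<exists>K C :: real. K \<ge> 1 \<and> C \<ge> 0 \<and>
      (\<forall>x\<in>X. \<forall>x'\<in>X. 1 / K * dX x x' - C \<le> dY (f x) (f x') \<and>
        dY (f x) (f x') \<le> K * dX x x' + C))"

definition powers_of_common_integer :: "nat \<Rightarrow> nat \<Rightarrow> bool" where
  "powers_of_common_integer m n \<longleftrightarrow>
    (\<exists>r s t :: nat. r > 0 \<and> s > 0 \<and> t > 0 \<and> m = r ^ s \<and> n = r ^ t)"

end

theory Submission
  imports Defs
begin

text \<open>
  \<open>BS(1,m)\<close> is a tree of horocycles: over each vertex of its Bass--Serre tree lies a horocycle. Let \<open>F\<close> be a
  quasiisometric embedding into \<open>BS(1,n)\<close>; only properness and the Lipschitz property are used.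

  First, \<open>F\<close> maps horocycles close to horocycles. Otherwise a horocycle \<open>H\<close> of the target separates
  the images of two points \<open>p, q\<close> of one source horocycle, and in each of three branches above it
  the crossings with \<open>H\<close> cut \<open>p\<close> from \<open>q\<close>. Order the crossings by their position on the line \<open>H\<close>. Deep
  crossings of different branches are far apart, so cutting the crossing cocycle at the position of a deep
  crossing of one branch gives a cocycle on the other two, and there its value on the path from \<open>p\<close> to \<open>q\<close>
  can be computed in either branch. Hence the three partial crossing counts, as step functions of the
  position, satisfy: where one jumps, the other two agree. Starting from \<open>0\<close>, two of them remain \<open>0\<close>
  forever, although all three must end at \<open>\<plusminus>1\<close>.

  Properness makes the induced maps of horocycles bilipschitz, and comparing horocycles at different
  heights shows that \<open>F\<close> sends height \<open>k\<close> to \<open>k log\<^sub>n m + O(1)\<close>. Therefore the tree vertices above a vertex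
  of height \<open>i\<close> are sent to boundedly many vertices of height about \<open>i log\<^sub>n m\<close>, those of siblings
  being disjoint. The ratio \<open>r = (number of these vertices) m\<^sup>i / n\<^sup>J\<^sup>(\<^sup>i\<^sup>)\<close> does not increase on average when
  passing to children, so below a vertex where it nearly attains its infimum it is nearly constant. Two
  descendants with the same number of vertices give \<open>m\<^sup>u = n\<^sup>w\<close> with \<open>u > 0\<close> (Cooper's argument for bilipschitz
  maps of \<open>m\<close>-adic numbers, without measures).

  Conversely, \<open>(x, k) \<mapsto> (x, \<lfloor>k s / t\<rfloor>)\<close> is a quasiisometry from \<open>BS(1, r\<^sup>s)\<close> to \<open>BS(1, r\<^sup>t)\<close>.
\<close>

section \<open>The affine model of the Cayley graph\<close>

declare split_paired_All [simp del] split_paired_Ex [simp del]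

definition scaled_ints :: "nat \<Rightarrow> int \<Rightarrow> real set" where
  "scaled_ints m b = range (\<lambda>j::int. of_int j * real m powi b)"

lemma scaled_intsI: "x = of_int j * real m powi b \<Longrightarrow> x \<in> scaled_ints m b"
  by (auto simp: scaled_ints_def)

lemma scaled_intsE:
  assumes "x \<in> scaled_ints m b"
  obtains j :: int where "x = of_int j * real m powi b"
  using assms by (auto simp: scaled_ints_def)

lemma scaled_ints_0 [simp]: "0 \<in> scaled_ints m b"
  by (rule scaled_intsI[of _ 0]) simp

lemma scaled_ints_add: "x \<in> scaled_ints m b \<Longrightarrow> y \<in> scaled_ints m b \<Longrightarrow> x + y \<in> scaled_ints m b"
  by (elim scaled_intsE) (auto simp: ring_distribs intro!: scaled_intsI[where j = "_ + _"])

lemma scaled_ints_minus: "x \<in> scaled_ints m b \<Longrightarrow> - x \<in> scaled_ints m b"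
  by (elim scaled_intsE) (auto intro!: scaled_intsI[where j = "- _"])

lemma scaled_ints_minus_commute: "x - y \<in> scaled_ints m b \<Longrightarrow> y - x \<in> scaled_ints m b"
  using scaled_ints_minus[of "x - y" m b] by simp

lemma scaled_ints_diff_trans:
  "x - y \<in> scaled_ints m b \<Longrightarrow> y - z \<in> scaled_ints m b \<Longrightarrow> x - z \<in> scaled_ints m b"
  using scaled_ints_add[of "x - y" m b "y - z"] by simp

lemma powi_eq_power_mult:
  assumes "m > 0" "b \<le> k"
  shows "real m powi k = real (m ^ nat (k - b)) * real m powi b"
proof -
  have "real m powi k = real m powi (int (nat (k - b)) + b)" using assms by simp
  also have "\<dots> = real m powi int (nat (k - b)) * real m powi b"
    using assms by (subst power_int_add) auto
  finally show ?thesis by (simp only: power_int_of_nat of_nat_power)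
qed

lemma powi_in_scaled_ints:
  assumes "m > 0" "b \<le> k"
  shows "of_int j * real m powi k \<in> scaled_ints m b"
  by (rule scaled_intsI[of _ "j * int (m ^ nat (k - b))"]) (simp add: powi_eq_power_mult[OF assms])

lemma scaled_ints_mono: "m > 0 \<Longrightarrow> b \<le> k \<Longrightarrow> scaled_ints m k \<subseteq> scaled_ints m b"
  by (auto elim!: scaled_intsE intro!: powi_in_scaled_ints)

lemma scaled_ints_monoD: "x \<in> scaled_ints m k \<Longrightarrow> m > 0 \<Longrightarrow> b \<le> k \<Longrightarrow> x \<in> scaled_ints m b"
  using scaled_ints_mono by blast

lemma of_int_powi_mem_scaled_ints_dvd:
  assumes "m > 0" "of_int a * real m powi k \<in> scaled_ints m (k + int d)"
  shows "int m ^ d dvd a"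
proof -
  from assms(2) obtain j where "of_int a * real m powi k = of_int j * real m powi (k + int d)"
    by (rule scaled_intsE)
  also have "real m powi (k + int d) = real m powi k * real m ^ d"
    using assms(1) by (subst power_int_add) (auto simp: power_int_of_nat)
  finally have "of_int a * real m powi k = (of_int j * real m ^ d) * real m powi k" by simp
  then have "(of_int a :: real) = of_int j * real m ^ d" using assms(1) by simp
  also have "\<dots> = of_int (j * int m ^ d)" by simp
  finally have "a = j * int m ^ d" by (simp only: of_int_eq_iff)
  then show ?thesis by simp
qed

text \<open>The pair \<open>(x, k)\<close> stands for the affine map \<open>y \<mapsto> x + m\<^sup>k y\<close>; the relation \<open>bs_step\<close> is
  adjacency in the Cayley graph of \<open>BS(1,m)\<close> in this affine representation.\<close>

type_synonym pt = "real \<times> int"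

definition bs_points :: "nat \<Rightarrow> pt set" where
  "bs_points m = {p. \<exists>b. fst p \<in> scaled_ints m b}"

inductive bs_step :: "nat \<Rightarrow> pt \<Rightarrow> pt \<Rightarrow> bool" for m where
  right: "bs_step m (x, k) (x + real m powi k, k)"
| left: "bs_step m (x, k) (x - real m powi k, k)"
| up: "bs_step m (x, k) (x, k + 1)"
| down: "bs_step m (x, k) (x, k - 1)"

text \<open>Since \<open>refl\<close> admits every \<open>N\<close>, the number \<open>N\<close>
  bounds the length of a path instead of prescribing it.\<close>

inductive near :: "nat \<Rightarrow> nat \<Rightarrow> pt \<Rightarrow> pt \<Rightarrow> bool" for m where
  refl: "near m N p p"
| step: "near m N p q \<Longrightarrow> bs_step m q r \<Longrightarrow> near m (Suc N) p r"

lemma bs_step_sym: "bs_step m p q \<Longrightarrow> bs_step m q p"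
proof (induction rule: bs_step.induct)
  case (right x k) show ?case using bs_step.left[of m "x + real m powi k" k] by simp
next
  case (left x k) show ?case using bs_step.right[of m "x - real m powi k" k] by simp
next
  case (up x k) show ?case using bs_step.down[of m x "k + 1"] by simp
next
  case (down x k) show ?case using bs_step.up[of m x "k - 1"] by simp
qed

lemma near_mono: "near m N p q \<Longrightarrow> N \<le> M \<Longrightarrow> near m M p q"
proof (induction arbitrary: M rule: near.induct)
  case (refl N p) show ?case by (rule near.refl)
next
  case (step N p q r)
  then obtain M' where "M = Suc M'" "N \<le> M'" by (cases M) auto
  with step show ?case using near.step by blast
qed

lemma near_trans: "near m M q r \<Longrightarrow> near m N p q \<Longrightarrow> near m (N + M) p r"
proof (induction arbitrary: N rule: near.induct)
  case (refl M q) then show ?case using near_mono by fastforce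
next
  case (step M q r s) then show ?case using near.step by fastforce
qed

lemma near_1: "bs_step m p q \<Longrightarrow> near m 1 p q"
  using near.step[OF near.refl[of m 0 p]] by simp

lemma near_sym: "near m N p q \<Longrightarrow> near m N q p"
proof (induction rule: near.induct)
  case (refl N p) show ?case by (rule near.refl)
next
  case (step N p q r)
  then show ?case using near_trans[OF step.IH near_1[OF bs_step_sym[OF step.hyps(2)]]] by simp
qed

lemma near_height: "near m N p q \<Longrightarrow> \<bar>snd q - snd p\<bar> \<le> int N"
  by (induction rule: near.induct) (auto elim!: bs_step.cases)

text \<open>The path never descends below height \<open>snd p - N\<close>, so each horizontal edge
  moves by a multiple of \<open>m\<close> to that power.\<close>

lemma near_diff:
  assumes "m > 0"
  shows "near m N p q \<Longrightarrow> fst q - fst p \<in> scaled_ints m (snd p - int N)"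
proof (induction rule: near.induct)
  case (step N p q r)
  have "fst q - fst p \<in> scaled_ints m (snd p - int (Suc N))"
    using step.IH assms scaled_ints_monoD by fastforce
  moreover have "fst r - fst q \<in> scaled_ints m (snd p - int (Suc N))"
  proof -
    have le: "snd p - int (Suc N) \<le> snd q" using near_height[OF step.hyps(1)] by linarith
    show ?thesis
      using step.hyps(2) le powi_in_scaled_ints[OF assms le, of 1] powi_in_scaled_ints[OF assms le, of "-1"]
      by cases auto
  qed
  ultimately show ?case using scaled_ints_add by fastforce
qed simp

text \<open>Dually, the path never rises above height \<open>snd p + N\<close>, which bounds each of
  its at most \<open>N\<close> horizontal edges.\<close>

lemma near_abs_diff:
  assumes "m > 0"
  shows "near m N p q \<Longrightarrow> \<bar>fst q - fst p\<bar> \<le> real N * real m powi (snd p + int N)"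
proof (induction rule: near.induct)
  case (step N p q r)
  have "\<bar>fst r - fst q\<bar> \<le> real m powi (snd q)"
    using step.hyps(2) by cases auto
  also have "\<dots> \<le> real m powi (snd p + int (Suc N))"
    using near_height[OF step.hyps(1)] assms by (intro power_int_increasing) auto
  finally have 1: "\<bar>fst r - fst q\<bar> \<le> real m powi (snd p + int (Suc N))" .
  have "real N * real m powi (snd p + int N) \<le> real N * real m powi (snd p + int (Suc N))"
    using assms by (intro mult_left_mono power_int_increasing) auto
  with step.IH 1 show ?case by (simp add: algebra_simps)
qed simp

text \<open>The sets \<open>scaled_ints m b\<close> grow as \<open>b\<close> decreases, so the
  exponent may be taken below any prescribed height.\<close>

lemma bs_points_iff: "m > 0 \<Longrightarrow> p \<in> bs_points m \<longleftrightarrow> (\<exists>b\<le>c. fst p \<in> scaled_ints m b)"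
  unfolding bs_points_def by (auto intro: scaled_ints_monoD min.cobounded1 min.cobounded2)

lemma bs_points_add:
  assumes "m > 0" "(x, k) \<in> bs_points m" "y \<in> scaled_ints m b"
  shows "(x + y, l) \<in> bs_points m"
proof -
  obtain b' where "b' \<le> b" "x \<in> scaled_ints m b'" using assms(2) bs_points_iff[OF assms(1), of _ b] by auto
  then have "x + y \<in> scaled_ints m b'" using scaled_ints_monoD[OF assms(3,1)] scaled_ints_add by blast
  then show ?thesis by (auto simp: bs_points_def)
qed

lemma bs_points_height: "(x, k) \<in> bs_points m \<Longrightarrow> (x, l) \<in> bs_points m"
  by (auto simp: bs_points_def)

lemma near_bs_points:
  assumes "m > 0" "near m N p q" "p \<in> bs_points m"
  shows "q \<in> bs_points m"
  using bs_points_add[OF assms(1), of "fst p" "snd p" _ _ "snd q"] near_diff[OF assms(1,2)] assms(3)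
  by fastforce

lemma bs_step_bs_points: "m > 0 \<Longrightarrow> bs_step m p q \<Longrightarrow> p \<in> bs_points m \<Longrightarrow> q \<in> bs_points m"
  by (rule near_bs_points[OF _ near_1])

lemma near_vertical: "near m N (x, k) (x, k + int N)"
proof (induction N)
  case (Suc N)
  then show ?case using near.step[OF Suc bs_step.up] by (simp add: algebra_simps)
qed (auto intro: near.refl)

lemma near_vertical_le: "k \<le> l \<Longrightarrow> near m (nat (l - k)) (x, k) (x, l)"
  using near_vertical[of m "nat (l - k)" x k] by simp

lemma near_horizontal: "near m N (x, k) (x + real N * real m powi k, k)"
proof (induction N)
  case (Suc N)
  then show ?case using near.step[OF Suc bs_step.right] by (simp add: algebra_simps)
qed (auto intro: near.refl)

lemma near_horizontal_int: "near m (nat \<bar>j\<bar>) (x, k) (x + of_int j * real m powi k, k)"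
proof (cases "j \<ge> 0")
  case True
  then show ?thesis using near_horizontal[of m "nat j" x k] by simp
next
  case False
  then show ?thesis
    using near_sym[OF near_horizontal[of m "nat (-j)" "x + of_int j * real m powi k" k]] by simp
qed

text \<open>Converse of \<open>near_diff\<close> and \<open>near_abs_diff\<close>: descend from
  \<open>p\<close> to height \<open>b\<close>, walk along at most \<open>B\<close> edges of that
  horocycle, and climb to \<open>q\<close>.\<close>

lemma near_of_diff:
  assumes m: "m > 0" and d: "fst q - fst p \<in> scaled_ints m b"
    and h: "b \<le> snd p" "b \<le> snd q" "snd p \<le> b + int A" "snd q \<le> b + int A"
    and B: "\<bar>fst q - fst p\<bar> \<le> real B * real m powi b"
  shows "near m (2 * A + B) p q"
proof -
  obtain x k y l where p: "p = (x, k)" and q: "q = (y, l)" by (cases p, cases q)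
  obtain j where j: "y - x = of_int j * real m powi b" using d p q by (auto elim: scaled_intsE)
  have "\<bar>of_int j\<bar> * real m powi b \<le> real B * real m powi b"
    using B m unfolding p q fst_conv j by (simp add: abs_mult power_int_abs)
  then have "\<bar>of_int j\<bar> \<le> real B" using m by simp
  then have jB: "nat \<bar>j\<bar> \<le> B" by linarith
  have 1: "near m A (x, k) (x, b)"
    using near_mono[OF near_sym[OF near_vertical_le[of b k m x]], of A] h p by simp
  have 2: "near m A (y, b) (y, l)"
    using near_mono[OF near_vertical_le[of b l m y], of A] h q by simp
  have 3: "near m B (x, b) (y, b)"
    using near_mono[OF near_horizontal_int[of m j x b] jB] j by (simp add: algebra_simps)
  from near_trans[OF 2 near_trans[OF 3 1]] show ?thesis
    unfolding p q by (rule near_mono) simp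
qed

text \<open>Cosets \<open>z + n\<^sup>b \<int>\<close> are the vertices at height \<open>b\<close> of the Bass--Serre tree; the cone consists of the
  points lying over the part of the tree above such a vertex.\<close>

definition bs_cone :: "nat \<Rightarrow> real \<Rightarrow> int \<Rightarrow> pt set" where
  "bs_cone n z b = {q. b \<le> snd q \<and> fst q - z \<in> scaled_ints n b}"

lemma coneD: "q \<in> bs_cone n z b \<Longrightarrow> b \<le> snd q" "q \<in> bs_cone n z b \<Longrightarrow> fst q - z \<in> scaled_ints n b"
  by (auto simp: bs_cone_def)

lemma cone_self: "b \<le> snd p \<Longrightarrow> p \<in> bs_cone n (fst p) b"
  by (simp add: bs_cone_def)

lemma near_cone:
  assumes "n > 0" "near n N q q'" "q \<in> bs_cone n z b"
  shows "q' \<in> bs_cone n z (b - int N)"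
proof -
  have "b \<le> snd q" using assms(3) by (rule coneD)
  then have "fst q' - fst q \<in> scaled_ints n (b - int N)"
    using near_diff[OF assms(1,2)] assms(1) by (auto intro: scaled_ints_monoD)
  moreover have "fst q - z \<in> scaled_ints n (b - int N)"
    using coneD(2)[OF assms(3)] assms(1) by (auto intro: scaled_ints_monoD)
  ultimately show ?thesis
    using \<open>b \<le> snd q\<close> near_height[OF assms(2)] scaled_ints_diff_trans by (auto simp: bs_cone_def)
qed

text \<open>Horizontal edges inside the cone move by multiples of \<open>n\<close> to the power
  \<open>b\<close>, so only a downward edge from height \<open>b\<close> leaves it. The last point
  before leaving lies on the bottom horocycle.\<close>

lemma near_cone_crossing:
  assumes "n > 0"
  shows "near n N q q' \<Longrightarrow> q \<in> bs_cone n z b \<Longrightarrow> q' \<notin> bs_cone n z b \<Longrightarrow>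
    \<exists>j::int. near n N q (z + of_int j * real n powi b, b)"
proof (induction rule: near.induct)
  case (step N p q r)
  show ?case
  proof (cases "q \<in> bs_cone n z b")
    case False
    then obtain j where "near n N p (z + of_int j * real n powi b, b)" using step by blast
    then show ?thesis using near_mono[of n N p _ "Suc N"] by auto
  next
    case True
    have "snd q = b"
    proof (rule ccontr)
      assume "snd q \<noteq> b"
      with coneD(1)[OF True] have "b + 1 \<le> snd q" by simp
      moreover have "fst r - fst q \<in> scaled_ints n b"
        using step.hyps(2) coneD(1)[OF True] powi_in_scaled_ints[OF assms, of b _ 1]
          powi_in_scaled_ints[OF assms, of b _ "-1"] by cases auto
      moreover have "snd r \<ge> snd q - 1" using step.hyps(2) by cases auto
      ultimately have "r \<in> bs_cone n z b"
        using coneD(2)[OF True] scaled_ints_diff_trans unfolding bs_cone_def by auto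
      with step.prems show False by simp
    qed
    obtain j where "fst q - z = of_int j * real n powi b" using coneD(2)[OF True] by (rule scaled_intsE)
    then have "q = (z + of_int j * real n powi b, b)" using \<open>snd q = b\<close> by (cases q) auto
    then show ?thesis using near_mono[OF step.hyps(1), of "Suc N"] by auto
  qed
qed simp

section \<open>Cones do not separate horocycles\<close>

lemma powi_add_nat: "m > 0 \<Longrightarrow> real m powi (b + int N) = real m ^ N * real m powi b"
  by (subst power_int_add) (auto simp: power_int_of_nat)

lemma sum_lessThan_add:
  fixes f :: "nat \<Rightarrow> 'a::comm_monoid_add"
  shows "(\<Sum>s<a + b. f s) = (\<Sum>s<a. f s) + (\<Sum>t<b. f (a + t))"
  by (induction b) (simp_all add: add.assoc)

text \<open>Invariant: two of the three functions vanish at \<open>c\<close>. When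
  \<open>h l\<close> jumps, any two indices include one of the other two, \<open>u\<close> or
  \<open>v\<close>; these agree and stay unchanged, so both are \<open>0\<close> at
  \<open>c + 1\<close>.\<close>

lemma three_step_functions:
  fixes h :: "nat \<Rightarrow> int \<Rightarrow> int"
  assumes init: "\<And>i. i < 3 \<Longrightarrow> h i c0 = 0"
    and single: "\<And>i j c. i < 3 \<Longrightarrow> j < 3 \<Longrightarrow> j \<noteq> i \<Longrightarrow> h i (c + 1) \<noteq> h i c \<Longrightarrow> h j (c + 1) = h j c"
    and agree: "\<And>i j k c. i < 3 \<Longrightarrow> j < 3 \<Longrightarrow> k < 3 \<Longrightarrow> j \<noteq> i \<Longrightarrow> k \<noteq> i \<Longrightarrow>
      h i (c + 1) \<noteq> h i c \<Longrightarrow> h j c = h k c"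
    and "c0 \<le> c"
  shows "\<exists>i<3. \<exists>j<3. i \<noteq> j \<and> h i c = 0 \<and> h j c = 0"
  using \<open>c0 \<le> c\<close>
proof (induction c rule: int_ge_induct)
  case base
  show ?case using init[of 0] init[of 1] by (intro exI[of _ 0] conjI exI[of _ 1]) auto
next
  case (step c)
  then obtain i j where ij: "i < 3" "j < 3" "i \<noteq> j" "h i c = 0" "h j c = 0" by blast
  show ?case
  proof (cases "\<exists>l<3. h l (c + 1) \<noteq> h l c")
    case False
    with ij show ?thesis by metis
  next
    case True
    then obtain l where l: "l < 3" "h l (c + 1) \<noteq> h l c" by blast
    obtain u v where uv: "u < 3" "v < 3" "u \<noteq> v" "u \<noteq> l" "v \<noteq> l"
    proof -
      have "l = 0 \<or> l = 1 \<or> l = 2" using l(1) by linarith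
      with that[of 1 2] that[of 0 2] that[of 0 1] show thesis by auto
    qed
    have eq: "h u c = h v c" using agree[OF l(1) uv(1,2,4,5) l(2)] .
    have "i = u \<or> i = v \<or> j = u \<or> j = v" using ij(1-3) uv l(1) by linarith
    then have "h u c = 0" "h v c = 0" using ij eq by auto
    moreover have "h u (c + 1) = h u c" "h v (c + 1) = h v c"
      using single[OF l(1) uv(1,4) l(2)] single[OF l(1) uv(2,5) l(2)] .
    ultimately show ?thesis using uv by auto
  qed
qed

text \<open>\<open>strip_row m x k i j s\<close> is the \<open>s\<close>-th point of the horocycle at height \<open>j\<close> over the horocycle of \<open>(x, k)\<close>,
  in the \<open>i\<close>-th of several upward branches; \<open>m\<close> consecutive edges of one row and one edge of the next
  row bound a relator cell.\<close>

definition strip_row :: "nat \<Rightarrow> real \<Rightarrow> int \<Rightarrow> nat \<Rightarrow> nat \<Rightarrow> int \<Rightarrow> pt" where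
  "strip_row m x k i j s = (x + of_int (int i + s * int m ^ j) * real m powi k, k + int j)"

section \<open>Strips in several branches over one horocycle\<close>

locale bs_coarse_embedding =
  fixes m n L :: nat and \<rho> :: "nat \<Rightarrow> nat" and F :: "pt \<Rightarrow> pt"
  assumes m2: "m \<ge> 2" and n2: "n \<ge> 2"
    and lip: "p \<in> bs_points m \<Longrightarrow> bs_step m p q \<Longrightarrow> near n L (F p) (F q)"
    and proper: "p \<in> bs_points m \<Longrightarrow> q \<in> bs_points m \<Longrightarrow> near n N (F p) (F q) \<Longrightarrow> near m (\<rho> N) p q"
begin

lemma m0: "m > 0" and n0: "n > 0" using m2 n2 by auto

lemma lip_near:
  assumes "p \<in> bs_points m" and "near m N p q"
  shows "near n (L * N) (F p) (F q)"
  using assms(2,1)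
proof (induction rule: near.induct)
  case (step N p q r)
  have "q \<in> bs_points m" using near_bs_points[OF m0 step.hyps(1) step.prems] .
  from near_trans[OF lip[OF this step.hyps(2)] step.IH[OF step.prems]] show ?case
    by (simp add: add.commute)
qed (rule near.refl)

lemma row_closed: "(x, k) \<in> bs_points m \<Longrightarrow> strip_row m x k i j s \<in> bs_points m"
  unfolding strip_row_def by (rule bs_points_add[OF m0 _ scaled_intsI[OF HOL.refl]])

lemma row_near: "near m (nat \<bar>u\<bar>) (strip_row m x k i j s) (strip_row m x k i j (s + u))"
proof -
  have "real m powi (k + int j) = real m ^ j * real m powi k"
    using m0 by (subst power_int_add) (auto simp: power_int_of_nat)
  then show ?thesis
    using near_horizontal_int[of m u "x + of_int (int i + s * int m ^ j) * real m powi k" "k + int j"]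
    by (simp add: strip_row_def algebra_simps)
qed

lemma row_step: "bs_step m (strip_row m x k i j s) (strip_row m x k i j (s + 1))"
proof -
  have "real m powi (k + int j) = real m ^ j * real m powi k"
    using m0 by (subst power_int_add) (auto simp: power_int_of_nat)
  then show ?thesis
    using bs_step.right[of m "x + of_int (int i + s * int m ^ j) * real m powi k" "k + int j"]
    by (simp add: strip_row_def algebra_simps)
qed

lemma row_up: "bs_step m (strip_row m x k i j (s * int m)) (strip_row m x k i (Suc j) s)"
  using bs_step.up[of m "x + of_int (int i + s * int m ^ Suc j) * real m powi k" "k + int j"]
  by (simp add: strip_row_def algebra_simps)

text \<open>For \<open>m = 2\<close> a vertex has only two children; three diverging branches exist because \<open>m\<^sup>2 > 2\<close>.\<close>

lemma row_far:
  assumes ii: "i < 3" "i' < 3" "i \<noteq> i'" and N: "near m N (strip_row m x k i D s) (strip_row m x k i' j t)"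
  shows "D < N + 2"
proof (rule ccontr)
  assume "\<not> D < N + 2"
  then have D: "N + 2 \<le> D" by simp
  \<comment> \<open>The heights of the two points differ by at most \<open>N\<close>, so both rows
    are at least \<open>2\<close> levels up. There the branch offset is determined modulo
    \<open>m ^ 2\<close>.\<close>
  have j: "2 \<le> j" using near_height[OF N] D by (simp add: strip_row_def)
  have "of_int (int i' - int i + t * int m ^ j - s * int m ^ D) * real m powi k \<in> scaled_ints m (k + int D - int N)"
    using near_diff[OF m0 N] by (simp add: strip_row_def algebra_simps)
  then have "of_int (int i' - int i + t * int m ^ j - s * int m ^ D) * real m powi k \<in> scaled_ints m (k + int 2)"
    by (rule scaled_ints_monoD[OF _ m0]) (use D in simp)
  then have "int m ^ 2 dvd int i' - int i + t * int m ^ j - s * int m ^ D"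
    by (rule of_int_powi_mem_scaled_ints_dvd[OF m0])
  moreover have "int m ^ 2 dvd t * int m ^ j" using j by (intro dvd_mult le_imp_power_dvd)
  moreover have "int m ^ 2 dvd s * int m ^ D" using D by (intro dvd_mult le_imp_power_dvd) simp
  ultimately have "int m ^ 2 dvd int i' - int i"
    by (metis dvd_add_left_iff dvd_diff_commute dvd_minus_iff diff_conv_add_uminus)
  then have "int m ^ 2 \<le> \<bar>int i' - int i\<bar>"
    using dvd_imp_le_int[of "int i' - int i" "int m ^ 2"] ii by auto
  moreover have "\<bar>int i' - int i\<bar> \<le> 2" using ii by auto
  moreover have "int m ^ 2 \<ge> 2 ^ 2" using m2 by (intro power_mono) auto
  ultimately show False by simp
qed

text \<open>The images of two crossings on one relator cell are joined by a path of length
  \<open>L * (m + 2)\<close>, and each is within \<open>2 * L\<close> of its boundary point. By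
  \<open>near_abs_diff\<close> a path of length \<open>M\<close> between boundary points changes the
  position by at most \<open>M * n ^ M\<close>.\<close>

definition gap :: nat where
  "gap = (4 * L + L * (m + 2)) * n ^ (4 * L + L * (m + 2))"

text \<open>By \<open>pos_far\<close>, crossings whose positions differ by at most
  \<open>gap\<close> are at distance at most \<open>\<rho> (4 * L + gap)\<close> in the source. By
  \<open>row_far\<close> this is impossible between row \<open>depth\<close> of one branch and any
  row of another.\<close>

definition depth :: nat where
  "depth = \<rho> (4 * L + gap) + 2"

end

section \<open>The crossing cocycle of a cone\<close>

locale bs_cone_cut = bs_coarse_embedding +
  fixes z :: real and b :: int
begin

definition side :: "pt \<Rightarrow> int" where
  "side p = (if F p \<in> bs_cone n z b then 1 else 0)"

definition horo :: "int \<Rightarrow> pt" where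
  "horo j = (z + of_int j * real n powi b, b)"

text \<open>Position along the boundary horocycle of the cone, meaningful only for crossing points
  (\<open>SOME\<close> over a possibly empty set otherwise).\<close>

definition pos :: "pt \<Rightarrow> int" where
  "pos p = (SOME j. near n (2 * L) (F p) (horo j))"

definition crossing :: "pt \<Rightarrow> bool" where
  "crossing p \<longleftrightarrow> p \<in> bs_points m \<and> (\<exists>q. bs_step m p q \<and> side q \<noteq> side p)"

text \<open>The coboundary of \<open>side\<close>, restricted to the crossings at positions before \<open>c\<close>. It is still a
  cocycle on every cell whose crossings stay away from \<open>c\<close>.\<close>

definition chi :: "int \<Rightarrow> pt \<Rightarrow> pt \<Rightarrow> int" where
  "chi c p q = (if pos p < c then side q - side p else 0)"

text \<open>An image path of length \<open>L\<close> passes through the boundary of the cone. If it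
  is traced from \<open>F q\<close>, reaching the boundary point from \<open>F p\<close> costs
  another \<open>L\<close>.\<close>

lemma crossing_near:
  assumes "crossing p"
  shows "near n (2 * L) (F p) (horo (pos p))"
proof -
  obtain q where q: "p \<in> bs_points m" "bs_step m p q" "side q \<noteq> side p"
    using assms by (auto simp: crossing_def)
  have near: "near n L (F p) (F q)" using lip q by blast
  have "\<exists>j. near n (2 * L) (F p) (horo j)"
  proof (cases "F p \<in> bs_cone n z b")
    case True
    then have "F q \<notin> bs_cone n z b" using q(3) by (auto simp: side_def)
    from near_cone_crossing[OF n0 near True this] obtain j where "near n L (F p) (horo j)"
      unfolding horo_def by blast
    then show ?thesis using near_mono[of n L _ _ "2 * L"] by fastforce
  next
    case False
    then have "F q \<in> bs_cone n z b" using q(3) by (auto simp: side_def split: if_splits)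
    from near_cone_crossing[OF n0 near_sym[OF near] this False] obtain j where "near n L (F q) (horo j)"
      unfolding horo_def by blast
    from near_trans[OF this near] show ?thesis by (auto simp: mult_2)
  qed
  then show ?thesis unfolding pos_def by (rule someI_ex)
qed

lemma pos_close:
  assumes "crossing p" "crossing q" "near m (m + 2) p q"
  shows "\<bar>pos p - pos q\<bar> \<le> int gap"
proof -
  let ?M = "4 * L + L * (m + 2)"
  have "near n (L * (m + 2)) (F p) (F q)"
    using lip_near[OF _ assms(3)] assms(1) by (simp only: crossing_def)
  from near_trans[OF crossing_near[OF assms(2)] near_trans[OF this near_sym[OF crossing_near[OF assms(1)]]]]
  have "near n ?M (horo (pos p)) (horo (pos q))" by (rule near_mono) simp
  from near_abs_diff[OF n0 this]
  have "\<bar>of_int (pos q - pos p) * real n powi b\<bar> \<le> real ?M * real n powi (b + int ?M)"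
    by (simp add: horo_def algebra_simps)
  also have "real n powi (b + int ?M) = real n ^ ?M * real n powi b"
    by (rule powi_add_nat[OF n0])
  finally have "\<bar>of_int (pos q - pos p)\<bar> * real n powi b \<le> (real ?M * real n ^ ?M) * real n powi b"
    by (simp add: abs_mult power_int_abs mult.assoc)
  then have "\<bar>of_int (pos q - pos p) :: real\<bar> \<le> real ?M * real n ^ ?M"
    using n0 by (subst (asm) mult_le_cancel_right_pos) auto
  also have "\<dots> = of_int (int gap)" unfolding gap_def by simp
  finally show ?thesis by linarith
qed

lemma pos_far:
  assumes "crossing p" "crossing q" "\<bar>pos p - pos q\<bar> \<le> int gap"
  shows "near m (\<rho> (4 * L + gap)) p q"
proof -
  have "near n (nat \<bar>pos q - pos p\<bar>) (horo (pos p)) (horo (pos q))"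
    using near_horizontal_int[of n "pos q - pos p" "fst (horo (pos p))" b]
    by (simp add: horo_def algebra_simps)
  then have "near n gap (horo (pos p)) (horo (pos q))"
    by (rule near_mono) (use assms(3) in simp)
  from near_trans[OF near_sym[OF crossing_near[OF assms(2)]] near_trans[OF this crossing_near[OF assms(1)]]]
  have "near n (4 * L + gap) (F p) (F q)" by (rule near_mono) simp
  then show ?thesis using proper assms(1,2) by (auto simp: crossing_def)
qed

lemma chi_cases:
  assumes "p \<in> bs_points m" "bs_step m p q"
  shows "crossing p \<Longrightarrow> pos p < c \<Longrightarrow> chi c p q = side q - side p"
    and "crossing p \<Longrightarrow> \<not> pos p < c \<Longrightarrow> chi c p q = 0"
    and "\<not> crossing p \<Longrightarrow> chi c p q = 0 \<and> side q = side p"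
  using assms by (auto simp: chi_def crossing_def)

text \<open>By \<open>pos_close\<close>, crossings on one cell have positions within
  \<open>gap\<close> of each other. As all avoid \<open>c\<close> by more than \<open>gap\<close>,
  they lie on one side of \<open>c\<close>; hence \<open>chi c\<close> is either the full coboundary
  of \<open>side\<close> or \<open>0\<close> on the whole cell, and its sum around the cell
  vanishes.\<close>

lemma brick:
  assumes xk: "(x, k) \<in> bs_points m"
    and avoid: "\<And>j' t. j' \<le> Suc j \<Longrightarrow> crossing (strip_row m x k i j' t) \<Longrightarrow> \<bar>pos (strip_row m x k i j' t) - c\<bar> > int gap"
  defines "R \<equiv> strip_row m x k i"
  shows "(\<Sum>t<m. chi c (R j (s * int m + int t)) (R j (s * int m + int t + 1))) =
    chi c (R j (s * int m)) (R (Suc j) s) + chi c (R (Suc j) s) (R (Suc j) (s + 1))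
      - chi c (R j ((s + 1) * int m)) (R (Suc j) (s + 1))"
proof -
  \<comment> \<open>\<open>B\<close> consists of the starting points of the edges of the cell,
    because \<open>chi\<close> evaluates \<open>pos\<close> only at the start of an edge.\<close>
  define B where "B = (\<lambda>t::nat. R j (s * int m + int t)) ` {..m} \<union> {R (Suc j) s}"
  have clo: "p \<in> bs_points m" if "p \<in> B" for p
    using that row_closed[OF xk] by (auto simp: B_def R_def)
  have near0: "near m m (R j (s * int m + int t)) (R j (s * int m + int u))" if "t \<le> m" "u \<le> m" for t u
    using near_mono[OF row_near[of "int u - int t" x k i j "s * int m + int t"], of m] that
    by (simp add: R_def algebra_simps)
  have near1: "near m (m + 1) (R j (s * int m + int t)) (R (Suc j) s)" if "t \<le> m" for t
  proof -
    have "near m m (R j (s * int m + int t)) (R j (s * int m))" using near0[OF that, of 0] by simp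
    from near_trans[OF near_1[OF row_up[of x k i j s]] this[unfolded R_def]] show ?thesis
      unfolding R_def .
  qed
  have near: "near m (m + 2) p q" if "p \<in> B" "q \<in> B" for p q
  proof -
    have "near m (m + 1) p q"
      using that near_mono[OF near0, of _ _ "m + 1"] near1 near_sym[OF near1] near.refl[of m "m + 1" q]
      unfolding B_def by auto
    then show ?thesis by (rule near_mono) simp
  qed
  have av: "\<bar>pos p - c\<bar> > int gap" if "p \<in> B" "crossing p" for p
    using that avoid unfolding B_def R_def by auto
  have "(\<forall>p\<in>B. crossing p \<longrightarrow> pos p < c) \<or> (\<forall>p\<in>B. crossing p \<longrightarrow> \<not> pos p < c)"
  proof (rule ccontr)
    assume "\<not> ?thesis"
    then obtain p q where pq: "p \<in> B" "crossing p" "\<not> pos p < c" "q \<in> B" "crossing q" "pos q < c" by blast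
    with pos_close[OF pq(2,5) near] av[OF pq(1,2)] av[OF pq(4,5)] show False by auto
  qed
  then have dich: "(\<forall>p\<in>B. \<forall>q. bs_step m p q \<longrightarrow> chi c p q = side q - side p) \<or>
      (\<forall>p\<in>B. \<forall>q. bs_step m p q \<longrightarrow> chi c p q = 0)"
    using chi_cases clo by (metis diff_self)
  have inB: "R j (s * int m + int t) \<in> B" if "t \<le> m" for t using that by (auto simp: B_def)
  have inB2: "R j (s * int m) \<in> B" "R j ((s + 1) * int m) \<in> B" "R (Suc j) s \<in> B"
    using inB[of 0] inB[of m] by (auto simp: B_def algebra_simps)
  have st: "bs_step m (R j t) (R j (t + 1))" "bs_step m (R j (t * int m)) (R (Suc j) t)"
     "bs_step m (R (Suc j) t) (R (Suc j) (t + 1))" for t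
    unfolding R_def by (rule row_step row_up)+
  from dich show ?thesis
  proof
    assume A: "\<forall>p\<in>B. \<forall>q. bs_step m p q \<longrightarrow> chi c p q = side q - side p"
    have "(\<Sum>t<m. chi c (R j (s * int m + int t)) (R j (s * int m + int t + 1))) =
        (\<Sum>t<m. side (R j (s * int m + int (Suc t))) - side (R j (s * int m + int t)))"
    proof (intro sum.cong)
      fix t assume "t \<in> {..<m}"
      then have "chi c (R j (s * int m + int t)) (R j (s * int m + int t + 1)) =
          side (R j (s * int m + int t + 1)) - side (R j (s * int m + int t))"
        using A inB[of t] st(1) by simp
      then show "chi c (R j (s * int m + int t)) (R j (s * int m + int t + 1)) =
          side (R j (s * int m + int (Suc t))) - side (R j (s * int m + int t))"
        by (simp add: algebra_simps)
    qed simp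
    also have "\<dots> = side (R j (s * int m + int m)) - side (R j (s * int m))"
      by (subst sum_lessThan_telescope) simp
    also have "s * int m + int m = (s + 1) * int m" by (simp add: algebra_simps)
    finally have "(\<Sum>t<m. chi c (R j (s * int m + int t)) (R j (s * int m + int t + 1))) =
      side (R j ((s + 1) * int m)) - side (R j (s * int m))" .
    moreover have "chi c (R j (s * int m)) (R (Suc j) s) = side (R (Suc j) s) - side (R j (s * int m))"
      "chi c (R (Suc j) s) (R (Suc j) (s + 1)) = side (R (Suc j) (s + 1)) - side (R (Suc j) s)"
      "chi c (R j ((s + 1) * int m)) (R (Suc j) (s + 1)) = side (R (Suc j) (s + 1)) - side (R j ((s + 1) * int m))"
      using A inB2 st by blast+
    ultimately show ?thesis by simp
  next
    assume A: "\<forall>p\<in>B. \<forall>q. bs_step m p q \<longrightarrow> chi c p q = 0"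
    then show ?thesis using inB inB2 st by simp
  qed
qed

definition row_sum :: "real \<Rightarrow> int \<Rightarrow> nat \<Rightarrow> nat \<Rightarrow> int \<Rightarrow> nat \<Rightarrow> int" where
  "row_sum x k i j c W = (\<Sum>s<W. chi c (strip_row m x k i j (int s)) (strip_row m x k i j (int s + 1)))"

text \<open>Put \<open>W\<close> cells side by side: the contributions of shared vertical edges
  cancel, leaving only those at the two ends.\<close>

lemma row_sum_up:
  assumes xk: "(x, k) \<in> bs_points m"
    and avoid: "\<And>j' t. j' \<le> Suc j \<Longrightarrow> crossing (strip_row m x k i j' t) \<Longrightarrow> \<bar>pos (strip_row m x k i j' t) - c\<bar> > int gap"
  shows "row_sum x k i j c (W * m) = row_sum x k i (Suc j) c W
    + chi c (strip_row m x k i j 0) (strip_row m x k i (Suc j) 0)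
    - chi c (strip_row m x k i j (int (W * m))) (strip_row m x k i (Suc j) (int W))"
proof (induction W)
  case 0 show ?case by (simp add: row_sum_def)
next
  case (Suc W)
  have "row_sum x k i j c (Suc W * m) = row_sum x k i j c (W * m) +
      (\<Sum>t<m. chi c (strip_row m x k i j (int W * int m + int t)) (strip_row m x k i j (int W * int m + int t + 1)))"
  proof -
    have "Suc W * m = W * m + m" by simp
    then show ?thesis unfolding row_sum_def by (simp only: sum_lessThan_add of_nat_add of_nat_mult)
  qed
  also note brick[OF xk avoid]
  finally show ?case using Suc.IH by (simp add: row_sum_def algebra_simps)
qed

text \<open>\<open>side\<close> is constant along each of the two vertical legs, so the boundary
  terms of \<open>row_sum_up\<close> vanish and the count passes unchanged from row to row.\<close>

lemma row_sum_up_iterate: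
  assumes xk: "(x, k) \<in> bs_points m"
    and avoid: "\<And>j t. j \<le> D \<Longrightarrow> crossing (strip_row m x k i j t) \<Longrightarrow> \<bar>pos (strip_row m x k i j t) - c\<bar> > int gap"
    and legs: "\<And>j. j \<le> D \<Longrightarrow> side (strip_row m x k i j 0) = a"
      "\<And>j. j \<le> D \<Longrightarrow> side (strip_row m x k i j (int (S * m ^ (D - j)))) = a'"
    and "j \<le> D"
  shows "row_sum x k i 0 c (S * m ^ D) = row_sum x k i j c (S * m ^ (D - j))"
  using \<open>j \<le> D\<close>
proof (induction j)
  case (Suc j)
  let ?W = "S * m ^ (D - Suc j)"
  have W: "S * m ^ (D - j) = ?W * m"
    using Suc.prems by (simp add: Suc_diff_Suc[symmetric])
  have "row_sum x k i j c (?W * m) = row_sum x k i (Suc j) c ?W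
    + chi c (strip_row m x k i j 0) (strip_row m x k i (Suc j) 0)
    - chi c (strip_row m x k i j (int (?W * m))) (strip_row m x k i (Suc j) (int ?W))"
    by (rule row_sum_up[OF xk avoid]) (use Suc.prems in auto)
  also have "chi c (strip_row m x k i j 0) (strip_row m x k i (Suc j) 0) = 0"
    using legs(1)[of j] legs(1)[of "Suc j"] Suc.prems by (simp add: chi_def)
  also have "chi c (strip_row m x k i j (int (?W * m))) (strip_row m x k i (Suc j) (int ?W)) = 0"
    using legs(2)[of j] legs(2)[of "Suc j"] Suc.prems unfolding W by (simp add: chi_def)
  finally show ?case using Suc W by simp
qed simp

text \<open>The bottom row of the next branch is the same row shifted by one edge. The edges lost
  and gained at the ends do not change \<open>side\<close>.\<close>

lemma row_sum_shift:
  assumes "side (strip_row m x k i 0 0) = side (strip_row m x k i 0 1)"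
    and "side (strip_row m x k i 0 (int W)) = side (strip_row m x k i 0 (int W + 1))"
  shows "row_sum x k (Suc i) 0 c W = row_sum x k i 0 c W"
proof -
  define f where "f s = chi c (strip_row m x k i 0 (int s)) (strip_row m x k i 0 (int s + 1))" for s
  have "row_sum x k (Suc i) 0 c W = (\<Sum>s<W. f (Suc s))"
    unfolding row_sum_def f_def by (simp add: strip_row_def algebra_simps)
  also have "\<dots> = (\<Sum>s<Suc W. f s) - f 0" by (subst sum.lessThan_Suc_shift) simp
  also have "\<dots> = (\<Sum>s<W. f s)" using assms by (simp add: f_def chi_def)
  finally show ?thesis by (simp add: row_sum_def f_def)
qed

lemma legs_near:
  assumes "i + j \<le> N"
  shows "near m N (strip_row m x k 0 0 (int (s * m ^ j))) (strip_row m x k i j (int s))"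
proof -
  have 1: "near m i (strip_row m x k 0 0 (int (s * m ^ j))) (strip_row m x k 0 0 (int (s * m ^ j) + int i))"
    using row_near[of "int i"] by simp
  have eq: "strip_row m x k 0 0 (int (s * m ^ j) + int i) = strip_row m x k i 0 (int (s * m ^ j))"
    by (simp add: strip_row_def)
  have 2: "near m j (strip_row m x k i 0 (int (s * m ^ j))) (strip_row m x k i j (int s))"
    using near_vertical[of m j _ k] by (simp add: strip_row_def)
  from near_trans[OF 2[folded eq] 1] show ?thesis by (rule near_mono) (use assms in simp)
qed

text \<open>The distance of the endpoints is a multiple of \<open>m ^ depth\<close>, so the leg
  above \<open>B\<close> meets row \<open>depth\<close> at the integer index \<open>S\<close>. The
  radius \<open>depth + 3\<close> contains the legs of all branches, so no edge of a leg changes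
  \<open>side\<close>.\<close>

lemma no_split:
  assumes xk: "(x, k) \<in> bs_points m"
    and S: "B = (x + of_int (int (S * m ^ depth)) * real m powi k, k)"
    and constA: "\<And>p. near m (depth + 3) (x, k) p \<Longrightarrow> side p = a"
    and constB: "\<And>p. near m (depth + 3) B p \<Longrightarrow> side p = a'"
  shows "a = a'"
proof -
  \<comment> \<open>The crossing count along the top row of branch \<open>i\<close>, restricted to
    positions before \<open>c\<close>: these are the three step functions.\<close>
  define h where "h i c = row_sum x k i depth c S" for i c
  have A0: "strip_row m x k 0 0 0 = (x, k)" and B0: "strip_row m x k 0 0 (int (S * m ^ depth)) = B"
    by (simp_all add: strip_row_def S)
  have legA: "side (strip_row m x k i j 0) = a" if "i < 4" "j \<le> depth" for i j
    using constA legs_near[of i j "depth + 3" x k 0] that by (simp add: A0)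
  have legB: "side (strip_row m x k i j (int (S * m ^ (depth - j)))) = a'" if "i < 4" "j \<le> depth" for i j
  proof -
    have "S * m ^ (depth - j) * m ^ j = S * m ^ depth"
      using that by (simp add: mult.assoc power_add[symmetric])
    then have "near m (depth + 3) (strip_row m x k 0 0 (int (S * m ^ depth))) (strip_row m x k i j (int (S * m ^ (depth - j))))"
      using legs_near[of i j "depth + 3" x k "S * m ^ (depth - j)"] that by (simp only:)
    then show ?thesis using constB unfolding B0 by blast
  qed
  \<comment> \<open>All three branches share the bottom row up to a shift, so their bottom counts
    agree.\<close>
  have shift: "row_sum x k i 0 c (S * m ^ depth) = row_sum x k 0 0 c (S * m ^ depth)" if "i < 3" for i c
    using that
  proof (induction i)
    case (Suc i)
    have sh: "strip_row m x k i 0 (s + 1) = strip_row m x k (Suc i) 0 s" for s by (simp add: strip_row_def)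
    have "row_sum x k (Suc i) 0 c (S * m ^ depth) = row_sum x k i 0 c (S * m ^ depth)"
    proof (rule row_sum_shift)
      show "side (strip_row m x k i 0 0) = side (strip_row m x k i 0 1)"
        using legA[of i 0] legA[of "Suc i" 0] Suc.prems sh[of 0] by simp
      show "side (strip_row m x k i 0 (int (S * m ^ depth))) = side (strip_row m x k i 0 (int (S * m ^ depth) + 1))"
        using legB[of i 0] legB[of "Suc i" 0] Suc.prems unfolding sh by simp
    qed
    with Suc show ?case by simp
  qed simp
  have jump: "\<exists>s. crossing (strip_row m x k i depth s) \<and> pos (strip_row m x k i depth s) = c"
    if "h i (c + 1) \<noteq> h i c" for i c
  proof -
    have "\<exists>s<S. chi (c + 1) (strip_row m x k i depth (int s)) (strip_row m x k i depth (int s + 1)) \<noteq>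
        chi c (strip_row m x k i depth (int s)) (strip_row m x k i depth (int s + 1))"
      using that unfolding h_def row_sum_def by (metis (no_types, lifting) lessThan_iff sum.cong)
    then obtain s where s: "chi (c + 1) (strip_row m x k i depth (int s)) (strip_row m x k i depth (int s + 1)) \<noteq>
        chi c (strip_row m x k i depth (int s)) (strip_row m x k i depth (int s + 1))" by blast
    then have "pos (strip_row m x k i depth (int s)) = c \<and>
        side (strip_row m x k i depth (int s + 1)) \<noteq> side (strip_row m x k i depth (int s))"
      by (auto simp: chi_def split: if_splits)
    then show ?thesis
      using row_step row_closed[OF xk] unfolding crossing_def by blast
  qed
  \<comment> \<open>A jump at \<open>c\<close> in branch \<open>i\<close> provides a crossing of its
    top row at position \<open>c\<close>; by the choice of \<open>depth\<close>, crossings of the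
    other branches keep away from \<open>c\<close>.\<close>
  have avoid: "\<bar>pos (strip_row m x k i' j t) - c\<bar> > int gap"
    if "i < 3" "i' < 3" "i' \<noteq> i" "h i (c + 1) \<noteq> h i c" "crossing (strip_row m x k i' j t)" for i i' c j t
  proof (rule ccontr)
    assume "\<not> ?thesis"
    moreover have "\<exists>s. crossing (strip_row m x k i depth s) \<and> pos (strip_row m x k i depth s) = c"
      using jump[OF that(4)] .
    then obtain s where s: "crossing (strip_row m x k i depth s)" "pos (strip_row m x k i depth s) = c"
      by blast
    ultimately have "near m (\<rho> (4 * L + gap)) (strip_row m x k i depth s) (strip_row m x k i' j t)"
      using pos_far[OF s(1) that(5)] by simp
    from row_far[OF that(1,2) that(3)[symmetric] this] show False by (simp add: depth_def)
  qed
  \<comment> \<open>So the cut at \<open>c\<close> is a cocycle on the strip of branch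
    \<open>i'\<close>, and its top count can be moved down to the common bottom row.\<close>
  have indep: "h i' c = row_sum x k 0 0 c (S * m ^ depth)"
    if "i < 3" "i' < 3" "i' \<noteq> i" "h i (c + 1) \<noteq> h i c" for i i' c
  proof -
    have "row_sum x k i' 0 c (S * m ^ depth) = row_sum x k i' depth c (S * m ^ (depth - depth))"
    proof (rule row_sum_up_iterate[OF xk])
      show "\<bar>pos (strip_row m x k i' j t) - c\<bar> > int gap" if "crossing (strip_row m x k i' j t)" for j t
        using avoid[OF \<open>i < 3\<close> \<open>i' < 3\<close> \<open>i' \<noteq> i\<close> \<open>h i (c + 1) \<noteq> h i c\<close> that] .
      show "side (strip_row m x k i' j 0) = a" if "j \<le> depth" for j
        using legA that \<open>i' < 3\<close> by simp
      show "side (strip_row m x k i' j (int (S * m ^ (depth - j)))) = a'" if "j \<le> depth" for j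
        using legB that \<open>i' < 3\<close> by simp
    qed simp
    then show ?thesis using shift[OF that(2)] by (simp add: h_def)
  qed
  \<comment> \<open>Only finitely many positions occur on the top rows. Before all of them every
    count is \<open>0\<close>; after all of them it is the full change of \<open>side\<close>,
    namely \<open>a' - a\<close>.\<close>
  define P where "P = (\<lambda>(i, s). pos (strip_row m x k i depth (int s))) ` ({..<3::nat} \<times> {..<S})"
  have fin: "finite P" by (simp add: P_def)
  obtain c0 where c0: "\<And>c. c \<in> P \<Longrightarrow> c0 \<le> c"
    using bdd_below_finite[OF fin] by (auto simp: bdd_below_def)
  obtain c1 where c1: "\<And>c. c \<in> P \<Longrightarrow> c \<le> c1"
    using bdd_above_finite[OF fin] by (auto simp: bdd_above_def)
  have inP: "pos (strip_row m x k i depth (int s)) \<in> P" if "i < 3" "s < S" for i s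
    using that unfolding P_def by force
  have h0: "h i c0 = 0" if "i < 3" for i
    unfolding h_def row_sum_def
    by (intro sum.neutral ballI) (use c0[OF inP] that in \<open>fastforce simp: chi_def\<close>)
  define c2 where "c2 = max c0 (c1 + 1)"
  have h1: "h i c2 = a' - a" if "i < 3" for i
  proof -
    have "h i c2 = (\<Sum>s<S. side (strip_row m x k i depth (int (Suc s))) - side (strip_row m x k i depth (int s)))"
      unfolding h_def row_sum_def
    proof (intro sum.cong)
      fix s assume "s \<in> {..<S}"
      then have "pos (strip_row m x k i depth (int s)) < c2"
        using c1[OF inP, of i s] that by (simp add: c2_def)
      then show "chi c2 (strip_row m x k i depth (int s)) (strip_row m x k i depth (int s + 1)) =
        side (strip_row m x k i depth (int (Suc s))) - side (strip_row m x k i depth (int s))"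
        by (simp add: chi_def add.commute)
    qed simp
    also have "\<dots> = side (strip_row m x k i depth (int S)) - side (strip_row m x k i depth 0)"
      by (subst sum_lessThan_telescope) simp
    finally show ?thesis using legA[of i depth] legB[of i depth] that by simp
  qed
  have "\<exists>i<3. \<exists>j<3. i \<noteq> j \<and> h i c2 = 0 \<and> h j c2 = 0"
  proof (rule three_step_functions[of h c0 c2])
    show "h j c = h l c" if "i < 3" "j < 3" "l < 3" "j \<noteq> i" "l \<noteq> i" "h i (c + 1) \<noteq> h i c" for i j l c
      using indep[of i j c] indep[of i l c] that by simp
    show "h j (c + 1) = h j c" if "i < 3" "j < 3" "j \<noteq> i" "h i (c + 1) \<noteq> h i c" for i j c
    proof (rule ccontr)
      assume "h j (c + 1) \<noteq> h j c"
      from jump[OF this] obtain s where "crossing (strip_row m x k j depth s)" "pos (strip_row m x k j depth s) = c"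
        by blast
      with avoid[OF that, of depth s] show False by simp
    qed
  qed (auto simp: h0 c2_def)
  then show ?thesis using h1 by auto
qed

end

section \<open>The induced maps between horocycles\<close>

lemma le_of_linear_bound:
  fixes a b e :: real
  assumes "\<And>t::nat. real t * a \<le> real t * b + e"
  shows "a \<le> b"
proof (rule ccontr)
  assume "\<not> a \<le> b"
  then obtain t :: nat where "e < real t * (a - b)" using reals_Archimedean3[of "a - b"] by auto
  with assms[of t] show False by (simp add: algebra_simps)
qed

lemma step_bound_iterate:
  fixes z :: "int \<Rightarrow> real"
  assumes "\<And>j. \<bar>z (j + 1) - z j\<bar> \<le> \<tau>"
  shows "\<bar>z (i + int t) - z i\<bar> \<le> real t * \<tau>"
proof (induction t)
  case (Suc t)
  have "\<bar>z (i + int t + 1) - z (i + int t)\<bar> \<le> \<tau>" by (rule assms)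
  with Suc show ?case by (simp add: algebra_simps)
qed simp

lemma discrete_intermediate_value:
  fixes z :: "int \<Rightarrow> real"
  assumes step: "\<And>j. \<bar>z (j + 1) - z j\<bar> \<le> \<tau>" and "0 \<le> \<tau>" and "a \<le> b" "z a \<le> \<zeta>" "\<zeta> \<le> z b"
  shows "\<exists>j. \<bar>z j - \<zeta>\<bar> \<le> \<tau>"
  using assms(3,5)
proof (induction b rule: int_ge_induct)
  case base then show ?case using assms(2,4) by (intro exI[of _ a]) auto
next
  case (step b)
  show ?case
  proof (cases "\<zeta> \<le> z b")
    case False
    then show ?thesis using step.prems assms(1)[of b] by (intro exI[of _ b]) auto
  qed (use step in blast)
qed

text \<open>Moving \<open>i\<close> or \<open>j\<close> by one changes the difference by at most
  \<open>\<tau>\<close>, but at separation \<open>G\<close> it exceeds \<open>\<tau>\<close> in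
  absolute value. So its sign cannot change, and all pairs with \<open>j - i\<close> at least
  \<open>G\<close> share it.\<close>

lemma coarse_monotone:
  fixes z :: "int \<Rightarrow> real"
  assumes step: "\<And>j. \<bar>z (j + 1) - z j\<bar> \<le> \<tau>"
    and sep: "\<And>i j. int G \<le> \<bar>j - i\<bar> \<Longrightarrow> \<tau> < \<bar>z j - z i\<bar>"
  shows "(\<forall>i j. int G \<le> j - i \<longrightarrow> \<tau> < z j - z i) \<or> (\<forall>i j. int G \<le> j - i \<longrightarrow> \<tau> < z i - z j)"
proof -
  define s where "s i j \<longleftrightarrow> z i < z j" for i j
  have s1: "s i (j + 1) = s i j" if "int G \<le> j - i" for i j
    using sep[of j i] sep[of "j + 1" i] step[of j] that unfolding s_def by (auto simp: abs_if split: if_splits)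
  have s2: "s (i + 1) (j + 1) = s i (j + 1)" if "int G \<le> j - i" for i j
    using sep[of "j + 1" i] sep[of "j + 1" "i + 1"] step[of i] that unfolding s_def by (auto simp: abs_if split: if_splits)
  have shift: "s (i + 1) (i + 1 + int G) = s i (i + int G)" for i
  proof -
    have "s i (i + int G + 1) = s i (i + int G)" by (rule s1) simp
    moreover have "s (i + 1) (i + int G + 1) = s i (i + int G + 1)" by (rule s2) simp
    moreover have "i + int G + 1 = i + 1 + int G" by simp
    ultimately show ?thesis by metis
  qed
  have diag: "s i (i + int G) = s 0 (int G)" for i
  proof (induction i rule: int_induct[where k = 0])
    case (step1 i)
    then show ?case using shift[of i] by simp
  next
    case (step2 i)
    then show ?case using shift[of "i - 1"] by simp
  qed simp
  have far: "s i (i + int G + int t) = s 0 (int G)" for i t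
  proof (induction t)
    case (Suc t)
    have "s i (i + int G + int t + 1) = s i (i + int G + int t)" by (rule s1) simp
    moreover have "i + int G + int (Suc t) = i + int G + int t + 1" by simp
    ultimately show ?case using Suc by (simp only:)
  qed (simp add: diag)
  have s: "s i j = s 0 (int G)" if "int G \<le> j - i" for i j
    using far[of i "nat (j - i - int G)"] that by simp
  have "\<tau> < \<bar>z j - z i\<bar>" if "int G \<le> j - i" for i j using sep[of j i] that by simp
  moreover have "s 0 (int G) \<Longrightarrow> z i < z j" "\<not> s 0 (int G) \<Longrightarrow> \<not> z i < z j" if "int G \<le> j - i" for i j
    using s[OF that] by (auto simp: s_def)
  ultimately show ?thesis by (cases "s 0 (int G)") (fastforce simp: abs_if split: if_splits)+
qed

text \<open>Every \<open>G\<close> steps gain more than \<open>\<tau>\<close>. This gives linear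
  growth, hence unboundedness in both directions, and the discrete intermediate value property gives
  coarse surjectivity.\<close>

lemma coarse_monotone_consequences:
  fixes z :: "int \<Rightarrow> real"
  assumes step: "\<And>j. \<bar>z (j + 1) - z j\<bar> \<le> \<tau>" and tau: "0 < \<tau>"
    and mono: "\<And>i j. int G \<le> j - i \<Longrightarrow> \<tau> < z j - z i"
  shows "real t * \<tau> \<le> z (i + int t * int G) - z i"
    and "\<exists>j. \<bar>z j - \<zeta>\<bar> \<le> \<tau>"
proof -
  have lower: "real t * \<tau> \<le> z (i + int t * int G) - z i" for i t
  proof (induction t)
    case (Suc t)
    have "\<tau> < z (i + int (Suc t) * int G) - z (i + int t * int G)"
      by (rule mono) (simp add: algebra_simps)
    with Suc show ?case by (simp add: algebra_simps)
  qed simp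
  show "real t * \<tau> \<le> z (i + int t * int G) - z i" by (rule lower)
  obtain t :: nat where t: "\<zeta> - z 0 < real t * \<tau>" using reals_Archimedean3[OF tau] by blast
  obtain u :: nat where u: "z 0 - \<zeta> < real u * \<tau>" using reals_Archimedean3[OF tau] by blast
  show "\<exists>j. \<bar>z j - \<zeta>\<bar> \<le> \<tau>"
  proof (rule discrete_intermediate_value[of z \<tau> "- (int u * int G)" "int t * int G" \<zeta>])
    show "\<bar>z (j + 1) - z j\<bar> \<le> \<tau>" for j by (rule step)
    show "z (- (int u * int G)) \<le> \<zeta>" using lower[of u "- (int u * int G)"] u by simp
    show "\<zeta> \<le> z (int t * int G)" using lower[of t 0] t by simp
    show "- (int u * int G) \<le> int t * int G" by (rule order_trans[of _ 0]) auto
  qed (use tau in simp)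
qed

lemma coarse_line:
  fixes z :: "int \<Rightarrow> real"
  assumes step: "\<And>j. \<bar>z (j + 1) - z j\<bar> \<le> \<tau>" and tau: "0 < \<tau>"
    and sep: "\<And>i j. int G \<le> \<bar>j - i\<bar> \<Longrightarrow> \<tau> < \<bar>z j - z i\<bar>"
  shows "real t * \<tau> \<le> \<bar>z (i + int t * int G) - z i\<bar>"
    and "\<exists>j. \<bar>z j - \<zeta>\<bar> \<le> \<tau>"
proof -
  have "real t * \<tau> \<le> \<bar>z (i + int t * int G) - z i\<bar> \<and> (\<exists>j. \<bar>z j - \<zeta>\<bar> \<le> \<tau>)"
    using coarse_monotone[of z \<tau> G, OF step sep]
  proof
    assume "\<forall>i j. int G \<le> j - i \<longrightarrow> \<tau> < z j - z i"
    then have mo: "\<tau> < z j - z i" if "int G \<le> j - i" for i j using that by blast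
    note cons = coarse_monotone_consequences[of z \<tau> G, OF step tau mo]
    show ?thesis using order_trans[OF cons(1)[of t i] abs_ge_self] cons(2)[of \<zeta>] by blast
  next
    assume A: "\<forall>i j. int G \<le> j - i \<longrightarrow> \<tau> < z i - z j"
    have st: "\<bar>- z (j + 1) - - z j\<bar> \<le> \<tau>" for j using step[of j] by simp
    have mo: "\<tau> < - z j - - z i" if "int G \<le> j - i" for i j using A that by simp
    obtain j where "\<bar>- z j - - \<zeta>\<bar> \<le> \<tau>"
      using coarse_monotone_consequences(2)[of "\<lambda>j. - z j" \<tau> G, OF st tau mo] by blast
    then have "\<bar>z j - \<zeta>\<bar> \<le> \<tau>" by simp
    moreover have "real t * \<tau> \<le> - z (i + int t * int G) - - z i"
      by (rule coarse_monotone_consequences(1)[of "\<lambda>j. - z j" \<tau> G, OF st tau mo])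
    ultimately show ?thesis by auto
  qed
  then show "real t * \<tau> \<le> \<bar>z (i + int t * int G) - z i\<bar>" and "\<exists>j. \<bar>z j - \<zeta>\<bar> \<le> \<tau>" by auto
qed

lemma (in bs_cone_cut) no_split_sides:
  assumes "(x, k) \<in> bs_points m"
    and "\<And>p. near m (depth + 3) (x, k) p \<Longrightarrow> F p \<in> bs_cone n z b \<longleftrightarrow> a"
    and "\<And>p. near m (depth + 3) (x + of_int (int (S * m ^ depth)) * real m powi k, k) p \<Longrightarrow>
      F p \<in> bs_cone n z b \<longleftrightarrow> a'"
  shows "a = a'"
proof -
  have "(if a then 1 else 0 :: int) = (if a' then 1 else 0)"
    by (rule no_split[OF assms(1) HOL.refl]) (use assms(2,3) in \<open>auto simp: side_def\<close>)
  then show ?thesis by (auto split: if_splits)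
qed

section \<open>Images of single horocycles\<close>

context bs_coarse_embedding
begin

text \<open>The first summand leaves room for the images of two balls of radius
  \<open>depth + 3\<close> on opposite sides of a cone boundary. The second pays for rounding an
  index to a multiple of \<open>m ^ depth\<close>.\<close>

definition width :: nat where
  "width = 2 * (L * (depth + 3)) + L * m ^ depth"

text \<open>The image of a ball of radius \<open>depth + 3\<close> has radius at most
  \<open>L * (depth + 3)\<close>. Height \<open>b\<close> is chosen halfway, so that by
  \<open>near_cone\<close> both balls stay on their sides.\<close>

lemma separating_cone:
  assumes p: "p \<in> bs_points m" and q: "q \<in> bs_points m"
    and notin: "F q \<notin> bs_cone n (fst (F p)) (snd (F p) - 2 * int (L * (depth + 3)))"
  defines "b \<equiv> snd (F p) - int (L * (depth + 3))"
  shows "near m (depth + 3) p p' \<Longrightarrow> F p' \<in> bs_cone n (fst (F p)) b"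
    and "near m (depth + 3) q q' \<Longrightarrow> F q' \<notin> bs_cone n (fst (F p)) b"
proof -
  assume "near m (depth + 3) p p'"
  from near_cone[OF n0 lip_near[OF p this] cone_self[of "snd (F p)"]]
  show "F p' \<in> bs_cone n (fst (F p)) b" by (simp add: b_def)
next
  assume "near m (depth + 3) q q'"
  note nr = near_sym[OF lip_near[OF q this]]
  show "F q' \<notin> bs_cone n (fst (F p)) b"
  proof
    assume "F q' \<in> bs_cone n (fst (F p)) b"
    from near_cone[OF n0 nr this] notin show False by (simp add: b_def)
  qed
qed

lemma fibre_closed: "(x, k) \<in> bs_points m \<Longrightarrow> (x + of_int j * real m powi k, k) \<in> bs_points m"
  by (rule bs_points_add[OF m0 _ scaled_intsI[OF HOL.refl]])

text \<open>If the image of a horocycle were not close to a single horocycle, a cone would separate two of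
  its points deeply, contradicting \<open>no_split\<close>.\<close>

lemma fibre_cone:
  assumes p: "(x, k) \<in> bs_points m"
  shows "F (x + of_int j * real m powi k, k) \<in> bs_cone n (fst (F (x, k))) (snd (F (x, k)) - int width)"
proof -
  define M where "M = m ^ depth"
  \<comment> \<open>\<open>no_split\<close> compares points whose distance is a multiple of
    \<open>m ^ depth\<close>, so the index \<open>j\<close> is rounded down to one.\<close>
  define q where "q = (x + of_int (j div int M * int M) * real m powi k, k)"
  have q: "q \<in> bs_points m" unfolding q_def by (rule fibre_closed[OF p])
  have q0: "F q \<in> bs_cone n (fst (F (x, k))) (snd (F (x, k)) - 2 * int (L * (depth + 3)))"
  proof (rule ccontr)
    assume notin: "\<not> ?thesis"
    interpret bs_cone_cut m n L \<rho> F "fst (F (x, k))" "snd (F (x, k)) - int (L * (depth + 3))"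
      by unfold_locales
    note sep = separating_cone[OF p q notin]
    show False
    proof (cases "j \<ge> 0")
      case True
      then have eq: "q = (x + of_int (int (nat (j div int M) * m ^ depth)) * real m powi k, k)"
        by (simp add: q_def M_def pos_imp_zdiv_nonneg_iff m0)
      show False
        using no_split_sides[OF p, of True "nat (j div int M)" False] sep(1) sep(2)[unfolded eq] by blast
    next
      \<comment> \<open>Now \<open>q\<close> lies to the left of \<open>(x, k)\<close>, and the two
        points exchange roles.\<close>
      case False
      then have "j div int M \<le> 0" using m0 by (simp add: M_def div_nonpos_pos_le0)
      then have "(x, k) = (fst q + of_int (int (nat (- (j div int M)) * m ^ depth)) * real m powi k, k)"
        by (simp add: q_def M_def algebra_simps)
      moreover have "q = (fst q, k)" by (simp add: q_def)
      ultimately show False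
        using no_split_sides[of "fst q" k False "nat (- (j div int M))" True] sep q by metis
    qed
  qed
  have "near m M q (x + of_int j * real m powi k, k)"
  proof -
    have "j = j div int M * int M + j mod int M" by simp
    then have "x + of_int j * real m powi k = fst q + of_int (j mod int M) * real m powi k"
      unfolding q_def by (metis (no_types, opaque_lifting) add.assoc distrib_right fst_conv of_int_add)
    then have "near m (nat \<bar>j mod int M\<bar>) q (x + of_int j * real m powi k, k)"
      using near_horizontal_int[of m "j mod int M" "fst q" k] unfolding \<open>x + of_int j * real m powi k = _\<close> by (simp add: q_def)
    moreover have "0 \<le> j mod int M" "j mod int M < int M" using m0 by (simp_all add: M_def)
    ultimately show ?thesis by (auto intro: near_mono)
  qed
  from near_cone[OF n0 lip_near[OF q this] q0] show ?thesis
    by (simp add: width_def M_def algebra_simps)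
qed

text \<open>Apply \<open>fibre_cone\<close> with either of the two points as base point.\<close>

lemma fibre_height:
  assumes p: "(x, k) \<in> bs_points m"
  shows "\<bar>snd (F (x + of_int j * real m powi k, k)) - snd (F (x, k))\<bar> \<le> int width"
  using coneD(1)[OF fibre_cone[OF p, of j]] coneD(1)[OF fibre_cone[OF fibre_closed[OF p, of j], of "- j"]]
  by simp

lemma fibre_diff:
  assumes p: "(x, k) \<in> bs_points m"
  shows "fst (F (x + of_int j * real m powi k, k)) - fst (F (x + of_int i * real m powi k, k))
    \<in> scaled_ints n (snd (F (x, k)) - int width)"
  using scaled_ints_diff_trans[OF coneD(2)[OF fibre_cone[OF p, of j]]
      scaled_ints_minus_commute[OF coneD(2)[OF fibre_cone[OF p, of i]]]] .

text \<open>The image of an edge has horizontal length at most \<open>L\<close> times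
  \<open>n\<close> to its height plus \<open>L\<close>, and heights along the horocycle vary by at
  most \<open>width\<close>. The summand \<open>1\<close> makes the constant positive.\<close>

definition stretch :: nat where
  "stretch = (L + 1) * n ^ (width + L)"

text \<open>If two images on a fibre are horizontally within one \<open>stretch\<close> unit,
  \<open>near_of_diff\<close> and properness put their preimages within \<open>r\<close>. Points of
  one horocycle within \<open>r\<close> have indices differing by at most
  \<open>r * m ^ r\<close>.\<close>

definition fibre_gap :: nat where
  "fibre_gap = (let r = \<rho> (2 * (2 * width) + stretch * n ^ width) in r * m ^ r + 1)"

lemma stretch_pos: "stretch > 0" using n0 by (simp add: stretch_def)

lemma fibre_step:
  assumes p: "(x, k) \<in> bs_points m"
  shows "\<bar>fst (F (x + of_int (j + 1) * real m powi k, k)) - fst (F (x + of_int j * real m powi k, k))\<bar>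
    \<le> real stretch * real n powi snd (F (x, k))"
proof -
  let ?P = "\<lambda>j. (x + of_int j * real m powi k, k)"
  have "bs_step m (?P j) (?P (j + 1))"
    using bs_step.right[of m "fst (?P j)" k] by (simp add: algebra_simps)
  from near_abs_diff[OF n0 lip[OF fibre_closed[OF p] this]]
  have "\<bar>fst (F (?P (j + 1))) - fst (F (?P j))\<bar> \<le> real L * real n powi (snd (F (?P j)) + int L)" .
  also have "\<dots> \<le> real (L + 1) * real n powi (snd (F (x, k)) + int (width + L))"
    using fibre_height[OF p, of j] n0 by (intro mult_mono power_int_increasing) auto
  also have "\<dots> = real stretch * real n powi snd (F (x, k))"
    unfolding powi_add_nat[OF n0] stretch_def using n0 by (simp add: algebra_simps)
  finally show ?thesis .
qed

lemma fibre_proper: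
  assumes p: "(x, k) \<in> bs_points m" and "int fibre_gap \<le> \<bar>j - i\<bar>"
  shows "real stretch * real n powi snd (F (x, k)) <
    \<bar>fst (F (x + of_int j * real m powi k, k)) - fst (F (x + of_int i * real m powi k, k))\<bar>"
proof (rule ccontr)
  let ?P = "\<lambda>j. (x + of_int j * real m powi k, k)"
  define r where "r = \<rho> (2 * (2 * width) + stretch * n ^ width)"
  define b where "b = snd (F (x, k)) - int width"
  assume "\<not> ?thesis"
  then have le: "\<bar>fst (F (?P j)) - fst (F (?P i))\<bar> \<le> real stretch * real n powi (b + int width)"
    by (simp add: b_def)
  have "near n (2 * (2 * width) + stretch * n ^ width) (F (?P i)) (F (?P j))"
  proof (rule near_of_diff[OF n0, where b = b])
    show "\<bar>fst (F (?P j)) - fst (F (?P i))\<bar> \<le> real (stretch * n ^ width) * real n powi b"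
      using le unfolding powi_add_nat[OF n0] by simp
  qed (use fibre_diff[OF p] fibre_height[OF p, of i] fibre_height[OF p, of j] in \<open>auto simp: b_def\<close>)
  then have "near m r (?P i) (?P j)"
    unfolding r_def by (rule proper[OF fibre_closed[OF p] fibre_closed[OF p]])
  from near_abs_diff[OF m0 this]
  have "\<bar>of_int (j - i) * real m powi k\<bar> \<le> real r * real m powi (k + int r)"
    by (simp add: algebra_simps)
  then have "\<bar>of_int (j - i)\<bar> * real m powi k \<le> (real r * real m ^ r) * real m powi k"
    unfolding powi_add_nat[OF m0] by (simp add: abs_mult power_int_abs mult.assoc)
  then have "\<bar>of_int (j - i) :: real\<bar> \<le> real r * real m ^ r"
    using m0 by (subst (asm) mult_le_cancel_right_pos) auto
  also have "\<dots> = of_int (int (r * m ^ r))" by simp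
  finally have "\<bar>j - i\<bar> \<le> int (r * m ^ r)" by linarith
  with assms(2) show False by (simp add: fibre_gap_def Let_def r_def)
qed

lemma fibre_lower:
  assumes "(x, k) \<in> bs_points m"
  shows "real t * (real stretch * real n powi snd (F (x, k))) \<le>
    \<bar>fst (F (x + of_int (int t * int fibre_gap) * real m powi k, k)) - fst (F (x, k))\<bar>"
proof -
  have "0 < real stretch * real n powi snd (F (x, k))" using stretch_pos n0 by simp
  from coarse_line(1)[where z = "\<lambda>j. fst (F (x + of_int j * real m powi k, k))" and t = t and i = 0,
      OF fibre_step[OF assms] this fibre_proper[OF assms]]
  show ?thesis by simp
qed

lemma fibre_upper:
  assumes "(x, k) \<in> bs_points m"
  shows "\<bar>fst (F (x + of_int (int t) * real m powi k, k)) - fst (F (x, k))\<bar> \<le>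
    real t * (real stretch * real n powi snd (F (x, k)))"
  using step_bound_iterate[of "\<lambda>j. fst (F (x + of_int j * real m powi k, k))",
      OF fibre_step[OF assms], of 0 t] by simp

lemma fibre_onto:
  assumes "(x, k) \<in> bs_points m"
  shows "\<exists>j. \<bar>fst (F (x + of_int j * real m powi k, k)) - \<zeta>\<bar> \<le> real stretch * real n powi snd (F (x, k))"
proof -
  have "0 < real stretch * real n powi snd (F (x, k))" using stretch_pos n0 by simp
  from coarse_line(2)[where z = "\<lambda>j. fst (F (x + of_int j * real m powi k, k))" and \<zeta> = \<zeta>,
      OF fibre_step[OF assms] this fibre_proper[OF assms]]
  show ?thesis by simp
qed

text \<open>Since both horocycles are mapped in a bilipschitz way and stay at bounded distance from each
  other, their images are stretched by the same amount.\<close>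

lemma height_compare:
  assumes p: "(x, k) \<in> bs_points m"
  shows "real m ^ d * real n powi snd (F (x, k)) \<le> real fibre_gap * real n powi snd (F (x, k + int d))"
    and "real n powi snd (F (x, k + int d)) \<le> real fibre_gap * (real m ^ d * real n powi snd (F (x, k)))"
proof -
  define z where "z j = fst (F (x + of_int j * real m powi k, k))" for j
  define z' where "z' j = fst (F (x + of_int j * real m powi (k + int d), k + int d))" for j
  define E where "E = real (L * d) * real n powi (snd (F (x, k)) + int (width + L * d))"
  define a where "a = real stretch * real n powi snd (F (x, k))"
  define a' where "a' = real stretch * real n powi snd (F (x, k + int d))"
  have p': "(x, k + int d) \<in> bs_points m" using p by (rule bs_points_height)
  \<comment> \<open>The error \<open>E\<close> is the same for all \<open>j\<close>, so
    \<open>le_of_linear_bound\<close> removes it below.\<close>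
  have close: "\<bar>z' j - z (j * int m ^ d)\<bar> \<le> E" for j
  proof -
    have eq: "x + of_int j * real m powi (k + int d) = x + of_int (j * int m ^ d) * real m powi k"
      unfolding powi_add_nat[OF m0] by simp
    have "near m d (x + of_int (j * int m ^ d) * real m powi k, k) (x + of_int (j * int m ^ d) * real m powi k, k + int d)"
      by (rule near_vertical)
    from near_abs_diff[OF n0 lip_near[OF fibre_closed[OF p] this]]
    have "\<bar>z' j - z (j * int m ^ d)\<bar> \<le> real (L * d) *
        real n powi (snd (F (x + of_int (j * int m ^ d) * real m powi k, k)) + int (L * d))"
      unfolding z_def z'_def eq .
    also have "\<dots> \<le> E" unfolding E_def using fibre_height[OF p, of "j * int m ^ d"] n0
      by (intro mult_left_mono power_int_increasing) auto
    finally show ?thesis .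
  qed
  have tri: "\<bar>\<bar>z' j - z' 0\<bar> - \<bar>z (j * int m ^ d) - z 0\<bar>\<bar> \<le> 2 * E" for j
    using close[of j] close[of 0] by (simp add: abs_if split: if_splits)
  have "(real m ^ d) * a \<le> real fibre_gap * a'"
  proof (rule le_of_linear_bound[where e = "2 * E"])
    fix t :: nat
    have "real t * (real m ^ d * a) \<le> \<bar>z (int t * int fibre_gap * int m ^ d) - z 0\<bar>"
      using fibre_lower[OF p, of "t * m ^ d"] by (simp add: z_def a_def algebra_simps)
    also have "\<dots> \<le> \<bar>z' (int t * int fibre_gap) - z' 0\<bar> + 2 * E"
      using tri[of "int t * int fibre_gap"] by linarith
    also have "\<dots> \<le> real t * (real fibre_gap * a') + 2 * E"
      using fibre_upper[OF p', of "t * fibre_gap"] by (simp add: z'_def a'_def algebra_simps)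
    finally show "real t * (real m ^ d * a) \<le> real t * (real fibre_gap * a') + 2 * E" .
  qed
  then have "real stretch * (real m ^ d * real n powi snd (F (x, k))) \<le>
      real stretch * (real fibre_gap * real n powi snd (F (x, k + int d)))"
    by (simp add: a_def a'_def mult_ac)
  then show "real m ^ d * real n powi snd (F (x, k)) \<le> real fibre_gap * real n powi snd (F (x, k + int d))"
    using stretch_pos by simp
  have "a' \<le> real fibre_gap * (real m ^ d * a)"
  proof (rule le_of_linear_bound[where e = "2 * E"])
    fix t :: nat
    have "real t * a' \<le> \<bar>z' (int t * int fibre_gap) - z' 0\<bar>"
      using fibre_lower[OF p', of t] by (simp add: z'_def a'_def algebra_simps)
    also have "\<dots> \<le> \<bar>z (int t * int fibre_gap * int m ^ d) - z 0\<bar> + 2 * E"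
      using tri[of "int t * int fibre_gap"] by linarith
    also have "\<dots> \<le> real t * (real fibre_gap * (real m ^ d * a)) + 2 * E"
      using fibre_upper[OF p, of "t * fibre_gap * m ^ d"] by (simp add: z_def a_def algebra_simps)
    finally show "real t * a' \<le> real t * (real fibre_gap * (real m ^ d * a)) + 2 * E" .
  qed
  then have "real stretch * real n powi snd (F (x, k + int d)) \<le>
      real stretch * (real fibre_gap * (real m ^ d * real n powi snd (F (x, k))))"
    by (simp add: a_def a'_def mult_ac)
  then show "real n powi snd (F (x, k + int d)) \<le> real fibre_gap * (real m ^ d * real n powi snd (F (x, k)))"
    using stretch_pos by simp
qed

text \<open>Compare \<open>(x, k)\<close> with \<open>(0, 0)\<close> by descending from both to a
  height \<open>b\<close> with \<open>x\<close> a multiple of \<open>m\<close> to the power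
  \<open>b\<close>. There \<open>(x, b)\<close> and \<open>(0, b)\<close> lie on one horocycle, so
  the images have almost equal heights.\<close>

lemma height_bound:
  "\<exists>Q>0. \<forall>p\<in>bs_points m. real m powi snd p \<le> Q * real n powi snd (F p) \<and>
    real n powi snd (F p) \<le> Q * real m powi snd p"
proof -
  define g where "g = real fibre_gap"
  define w where "w = real n ^ width"
  define c where "c = real n powi snd (F (0, 0))"
  \<comment> \<open>The factor \<open>g\<^sup>2\<close> comes from the two vertical comparisons,
    \<open>w\<close> from the passage along the horocycle, and \<open>c\<close> from the image of
    \<open>(0, 0)\<close>.\<close>
  define Q where "Q = max (g\<^sup>2 * w / c) (g\<^sup>2 * w * c)"
  have g: "g \<ge> 1" by (simp add: g_def fibre_gap_def Let_def)
  have w: "w > 0" and c: "c > 0" using n0 by (simp_all add: w_def c_def)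
  have "real m powi k \<le> Q * real n powi snd (F (x, k)) \<and> real n powi snd (F (x, k)) \<le> Q * real m powi k"
    if p: "(x, k) \<in> bs_points m" for x k
  proof -
    obtain b where b: "b \<le> min 0 k" "x \<in> scaled_ints m b"
      using p bs_points_iff[OF m0, of _ "min 0 k"] by auto
    obtain j where j: "x = 0 + of_int j * real m powi b" using b(2) by (auto elim: scaled_intsE)
    have px: "(x, b) \<in> bs_points m" using p by (rule bs_points_height)
    have p0: "(0, b) \<in> bs_points m" by (auto simp: bs_points_def)
    define d e where "d = nat (k - b)" and "e = nat (- b)"
    have de: "k = b + int d" "b + int e = 0" using b(1) by (simp_all add: d_def e_def)
    define A B C where "A = real n powi snd (F (x, k))" and "B = real n powi snd (F (x, b))"
      and "C = real n powi snd (F (0, b))"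
    have pos: "A > 0" "B > 0" "C > 0" using n0 by (simp_all add: A_def B_def C_def)
    define u v where "u = real m ^ d" and "v = real m ^ e"
    have uv: "u > 0" "v > 0" using m0 by (simp_all add: u_def v_def)
    have mk: "real m powi k * v = u"
    proof -
      have "real m powi k * v = real m powi k * real m powi (int e)" by (simp add: v_def power_int_of_nat)
      also have "\<dots> = real m powi (k + int e)" using m0 by (subst power_int_add) auto
      also have "k + int e = int d" using de by simp
      finally show ?thesis by (simp add: u_def power_int_of_nat)
    qed
    have 1: "u * B \<le> g * A" "A \<le> g * (u * B)"
      using height_compare[OF px, of d] unfolding de(1)[symmetric] by (simp_all add: u_def A_def B_def g_def)
    have 2: "v * C \<le> g * c" "c \<le> g * (v * C)"
      using height_compare[OF p0, of e] unfolding de(2) by (simp_all add: v_def C_def c_def g_def)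
    have h: "\<bar>snd (F (x, b)) - snd (F (0, b))\<bar> \<le> int width"
      using fibre_height[OF p0, of j] j by simp
    have 3: "B \<le> w * C"
      unfolding B_def C_def w_def powi_add_nat[OF n0, symmetric] using h n0
      by (intro power_int_increasing) auto
    have 4: "C \<le> w * B"
      unfolding B_def C_def w_def powi_add_nat[OF n0, symmetric] using h n0
      by (intro power_int_increasing) auto
    have "A * v \<le> g * (u * B) * v" using 1(2) uv by simp
    also have "\<dots> \<le> g * (u * (w * C)) * v"
      using 3 g uv by simp
    also have "\<dots> = g * u * w * (v * C)" by simp
    also have "\<dots> \<le> g * u * w * (g * c)" using 2(1) g uv w by (intro mult_left_mono) auto
    also have "\<dots> = (g\<^sup>2 * w * c * real m powi k) * v" by (simp add: mk[symmetric] power2_eq_square)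
    finally have "A \<le> g\<^sup>2 * w * c * real m powi k" using uv(2) by simp
    also have "\<dots> \<le> Q * real m powi k" unfolding Q_def by (intro mult_right_mono) auto
    finally have up: "A \<le> Q * real m powi k" .
    have "c * u \<le> g * (v * C) * u" using 2(2) uv by simp
    also have "\<dots> \<le> g * (v * (w * B)) * u" using 4 g uv by simp
    also have "\<dots> = g * v * w * (u * B)" by simp
    also have "\<dots> \<le> g * v * w * (g * A)" using 1(1) g uv w by (intro mult_left_mono) auto
    finally have "c * real m powi k * v \<le> (g\<^sup>2 * w * A) * v"
      by (simp add: mk[symmetric] power2_eq_square mult_ac)
    then have "c * real m powi k \<le> g\<^sup>2 * w * A" using uv(2) by simp
    then have "real m powi k \<le> g\<^sup>2 * w / c * A" using c by (simp add: field_simps)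
    also have "\<dots> \<le> Q * A" unfolding Q_def using pos by (intro mult_right_mono) auto
    finally show ?thesis using up by (simp add: A_def)
  qed
  moreover have "Q > 0" using g w c by (auto simp: Q_def less_max_iff_disj)
  ultimately show ?thesis by (auto intro!: exI[of _ Q])
qed

end

section \<open>Counting tree vertices\<close>

text \<open>Euclid's algorithm on the exponents: if \<open>u < w\<close> then \<open>n\<close>
  divides \<open>m\<close>, and \<open>m = n * c\<close> gives \<open>c ^ u = n ^ (w - u)\<close>,
  with smaller exponent sum. A common base for \<open>c\<close> and \<open>n\<close> is one for
  \<open>m\<close> and \<open>n\<close>.\<close>

lemma powers_of_common_integerI:
  assumes "m \<ge> 2" "n \<ge> 2" "m ^ u = n ^ w" "u > 0"
  shows "powers_of_common_integer m n"
proof -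
  have aux: "\<exists>r s t. m = r ^ s \<and> n = r ^ t"
    if "m \<ge> 2" "n \<ge> 2" "m ^ u = n ^ w" "u > 0" "w > 0" for m n u w :: nat
    using that
  proof (induction "u + w" arbitrary: m n u w rule: less_induct)
    case less
    have reduce: "\<exists>r s t. m = r ^ s \<and> n = r ^ t"
      if uw: "u < w" "u > 0" and mn: "m \<ge> 2" "n \<ge> 2" "m ^ u = n ^ w"
        and IH: "\<And>c. c \<ge> 2 \<Longrightarrow> c ^ u = n ^ (w - u) \<Longrightarrow> \<exists>r s t. c = r ^ s \<and> n = r ^ t"
      for m n u w :: nat
    proof -
      have "n ^ u dvd m ^ u" using uw mn by (simp add: le_imp_power_dvd)
      then obtain c where c: "m = n * c" using uw by (auto elim: dvdE)
      have "n ^ u * c ^ u = n ^ u * n ^ (w - u)"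
        using mn(3) uw unfolding c by (simp add: power_mult_distrib flip: power_add)
      then have cu: "c ^ u = n ^ (w - u)" using mn by simp
      have "c \<noteq> 0" using c mn(1) by (metis mult_0_right not_numeral_le_zero)
      moreover have "c \<noteq> 1" using cu uw mn(2) one_less_power[of n "w - u"] by auto
      ultimately have "c \<ge> 2" by simp
      from IH[OF this cu] obtain r s t where "c = r ^ s" "n = r ^ t" by blast
      then have "m = r ^ (t + s)" "n = r ^ t" using c by (simp_all add: power_add)
      then show ?thesis by blast
    qed
    consider "u = w" | "u < w" | "w < u" by linarith
    then show ?case
    proof cases
      case 1
      then have "m = n" using less.prems power_eq_iff_eq_base[of u m n] by simp
      then show ?thesis by (intro exI[of _ m] exI[of _ 1]) simp
    next
      case 2
      have "\<exists>r s t. c = r ^ s \<and> n = r ^ t" if "c \<ge> 2" "c ^ u = n ^ (w - u)" for c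
        using less.hyps[OF _ that(1) less.prems(2) that(2)] 2 less.prems(4) by simp
      from reduce[OF 2 less.prems(4,1,2,3) this] show ?thesis .
    next
      case 3
      have "\<exists>r s t. c = r ^ s \<and> m = r ^ t" if "c \<ge> 2" "c ^ w = m ^ (u - w)" for c
        using less.hyps[OF _ that(1) less.prems(1) that(2)] 3 less.prems(5) by simp
      from reduce[OF 3 less.prems(5,2,1) less.prems(3)[symmetric] this] show ?thesis by blast
    qed
  qed
  have "w > 0" using assms by (cases w) auto
  from aux[OF assms(1-4) this] obtain r s t where rst: "m = r ^ s" "n = r ^ t" by blast
  moreover have "s > 0" "t > 0" using rst assms(1,2) by (auto intro: gr0I)
  moreover have "r > 0" using rst(1) assms(1) \<open>s > 0\<close> by (cases "r = 0") (auto simp: power_0_left)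
  ultimately show ?thesis unfolding powers_of_common_integer_def by blast
qed

text \<open>Along a branch starting where the normalised count \<open>r\<close> is nearly minimal, \<open>r\<close> is nearly
  constant; two vertices with equal counts then force \<open>m\<^sup>u / n\<^sup>w\<close> to be extremely close to \<open>1\<close>.\<close>

lemma power_eq_of_branching_counts:
  fixes a :: "'v \<Rightarrow> nat" and child :: "'v \<Rightarrow> nat \<Rightarrow> 'v" and ht :: "'v \<Rightarrow> int" and J :: "int \<Rightarrow> int"
  assumes m: "m > 0" and n: "n > 0" and base: "base \<in> V"
    and child: "\<And>v i. v \<in> V \<Longrightarrow> i < m \<Longrightarrow> child v i \<in> V"
    and ht: "\<And>v i. v \<in> V \<Longrightarrow> i < m \<Longrightarrow> ht (child v i) = ht v + 1"
    and a1: "\<And>v. v \<in> V \<Longrightarrow> 1 \<le> a v" and aN: "\<And>v. v \<in> V \<Longrightarrow> a v \<le> N"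
    and sum: "\<And>v. v \<in> V \<Longrightarrow> (\<Sum>i<m. a (child v i)) \<le> n ^ nat (J (ht v + 1) - J (ht v)) * a v"
    and J: "\<And>i. J i \<le> J (i + 1)" and c: "\<And>i. real n powi J i \<le> c * real m powi i"
  shows "\<exists>u w. u > 0 \<and> m ^ u = n ^ w"
proof (rule ccontr)
  assume neq: "\<not> ?thesis"
  define r where "r v = real (a v) * real m powi ht v / real n powi J (ht v)" for v
  define s where "s = Inf (r ` V)"
  have "0 < real n powi J 0" using n by simp
  with c[of 0] have c0: "c > 0" using m by simp
  have r_lower: "1 / c \<le> r v" if "v \<in> V" for v
  proof -
    have "real n powi J (ht v) \<le> c * (real (a v) * real m powi ht v)"
    proof -
      have "1 * real m powi ht v \<le> real (a v) * real m powi ht v"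
        using a1[OF that] by (intro mult_right_mono) auto
      then have "c * real m powi ht v \<le> c * (real (a v) * real m powi ht v)" using c0 by simp
      with c show ?thesis by (rule order_trans)
    qed
    then show ?thesis unfolding r_def using n c0 by (simp add: field_simps)
  qed
  have bdd: "bdd_below (r ` V)" using r_lower by (auto simp: bdd_below_def)
  have s_le: "s \<le> r v" if "v \<in> V" for v unfolding s_def using that bdd by (intro cInf_lower) auto
  have "1 / c \<le> s" unfolding s_def using base r_lower by (intro cInf_greatest) auto
  then have s0: "s > 0" using c0 by (auto intro: less_le_trans[rotated])
  have r_sum: "(\<Sum>i<m. r (child v i)) \<le> real m * r v" if v: "v \<in> V" for v
  proof -
    define d where "d = nat (J (ht v + 1) - J (ht v))"
    have Jd: "real n powi J (ht v + 1) = real (n ^ d) * real n powi J (ht v)"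
      unfolding d_def by (rule powi_eq_power_mult[OF n J])
    have mm: "real m powi (ht v + 1) = real m * real m powi ht v"
      using m by (simp add: power_int_add_1')
    have "(\<Sum>i<m. r (child v i)) =
        (\<Sum>i<m. real (a (child v i)) * (real m powi (ht v + 1) / real n powi J (ht v + 1)))"
      by (intro sum.cong) (auto simp: r_def ht[OF v])
    also have "\<dots> = real (\<Sum>i<m. a (child v i)) * (real m powi (ht v + 1) / real n powi J (ht v + 1))"
      by (simp only: of_nat_sum sum_distrib_right)
    also have "\<dots> \<le> real (n ^ d * a v) * (real m powi (ht v + 1) / real n powi J (ht v + 1))"
      using sum[OF v] by (intro mult_right_mono) (auto simp del: of_nat_sum of_nat_mult simp: d_def)
    also have "\<dots> = real m * r v" unfolding Jd mm r_def using n by simp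
    finally show ?thesis .
  qed
  \<comment> \<open>All children have ratio at least \<open>s\<close> and their average is at most
    \<open>r v\<close>, so one child can exceed \<open>s\<close> by at most \<open>m\<close> times
    the excess of its parent.\<close>
  have excess: "r (child v 0) - s \<le> real m * (r v - s)" if v: "v \<in> V" for v
  proof -
    have "r (child v 0) - s \<le> (\<Sum>i<m. r (child v i) - s)"
      using m s_le child[OF v] by (intro member_le_sum[of 0 _ "\<lambda>i. r (child v i) - s"]) auto
    also have "\<dots> = (\<Sum>i<m. r (child v i)) - real m * s" by (simp add: sum_subtractf)
    also have "\<dots> \<le> real m * (r v - s)" using r_sum[OF v] by (simp add: algebra_simps)
    finally show ?thesis .
  qed
  \<comment> \<open>One factor \<open>m ^ N\<close> absorbs the growth of the excess along
    \<open>N\<close> generations, the other the factor \<open>m ^ u\<close> in the final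
    comparison.\<close>
  define eps where "eps = s / (2 * real m ^ (2 * N))"
  have eps: "eps > 0" using s0 m by (simp add: eps_def)
  obtain v where v: "v \<in> V" "r v < s + eps"
    using cInf_less_iff[of "r ` V" "s + eps"] base bdd eps by (auto simp: s_def)
  define b where "b k = ((\<lambda>v. child v 0) ^^ k) v" for k
  have bV: "b k \<in> V \<and> ht (b k) = ht v + int k" for k
    by (induction k) (use v child ht m in \<open>auto simp: b_def\<close>)
  have be: "r (b k) - s \<le> real m ^ k * eps" for k
  proof (induction k)
    case 0 show ?case using v by (simp add: b_def)
  next
    case (Suc k)
    have "r (b (Suc k)) - s \<le> real m * (r (b k) - s)"
      using excess[of "b k"] bV by (simp add: b_def)
    also have "\<dots> \<le> real m * (real m ^ k * eps)" using Suc by (intro mult_left_mono) auto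
    finally show ?case by simp
  qed
  \<comment> \<open>Pigeonhole: \<open>N + 1\<close> vertices of the branch have counts between
    \<open>1\<close> and \<open>N\<close>.\<close>
  have "\<not> inj_on (\<lambda>k. a (b k)) {..N}"
  proof
    assume "inj_on (\<lambda>k. a (b k)) {..N}"
    then have "card {..N} \<le> card {1..N}"
      by (rule card_inj_on_le) (use bV a1 aN in auto)
    then show False by simp
  qed
  then obtain k k' where k: "k < k'" "k' \<le> N" "a (b k) = a (b k')"
    unfolding inj_on_def by (metis atMost_iff linorder_neqE_nat)
  define u where "u = k' - k"
  define w where "w = nat (J (ht (b k')) - J (ht (b k)))"
  have u: "u > 0" "u \<le> N" using k by (auto simp: u_def)
  have Jmono: "J i \<le> J (i + int d)" for i d
  proof (induction d)
    case (Suc d) then show ?case using J[of "i + int d"] by (simp add: algebra_simps)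
  qed simp
  have hk: "ht (b k') = ht (b k) + int u" using bV k by (simp add: u_def)
  have Jw: "real n powi J (ht (b k')) = real (n ^ w) * real n powi J (ht (b k))"
    unfolding w_def by (rule powi_eq_power_mult[OF n]) (simp add: hk Jmono)
  have "r (b k) * real m ^ u = r (b k') * real n ^ w"
    unfolding r_def Jw unfolding hk powi_add_nat[OF m] k(3) using n by (simp add: field_simps)
  have "m ^ u \<noteq> n ^ w" using neq u by blast
  have "r (b k') * \<bar>real n ^ w - real m ^ u\<bar> = real m ^ u * \<bar>r (b k) - r (b k')\<bar>"
  proof -
    have "r (b k') * (real n ^ w - real m ^ u) = real m ^ u * (r (b k) - r (b k'))"
      using \<open>r (b k) * real m ^ u = r (b k') * real n ^ w\<close> by (simp add: algebra_simps)
    then have "\<bar>r (b k') * (real n ^ w - real m ^ u)\<bar> = \<bar>real m ^ u * (r (b k) - r (b k'))\<bar>"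
      by (simp only:)
    moreover have "s \<le> r (b k')" using s_le bV by blast
    then have "r (b k') > 0" using s0 by linarith
    ultimately show ?thesis by (simp add: abs_mult)
  qed
  \<comment> \<open>Distinct integers differ by at least \<open>1\<close>, which contradicts the
    near constancy of \<open>r\<close>.\<close>
  moreover have "1 \<le> \<bar>real n ^ w - real m ^ u\<bar>"
  proof -
    have "1 \<le> \<bar>int (n ^ w) - int (m ^ u)\<bar>" using \<open>m ^ u \<noteq> n ^ w\<close> by linarith
    then have "1 \<le> \<bar>real_of_int (int (n ^ w) - int (m ^ u))\<bar>" by linarith
    then show ?thesis by simp
  qed
  moreover have "s \<le> r (b k')" using s_le bV by blast
  ultimately have "s * 1 \<le> real m ^ u * \<bar>r (b k) - r (b k')\<bar>"
    using s0 mult_mono[of s "r (b k')" 1 "\<bar>real n ^ w - real m ^ u\<bar>"] by simp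
  also have "\<bar>r (b k) - r (b k')\<bar> \<le> real m ^ N * eps"
  proof -
    have "real m ^ l * eps \<le> real m ^ N * eps" if "l \<le> N" for l
      using that m eps by (intro mult_right_mono power_increasing) auto
    then have "r (b l) - s \<le> real m ^ N * eps" if "l \<le> N" for l using be[of l] that by force
    from this[of k] this[of k'] k s_le[of "b k"] s_le[of "b k'"] bV show ?thesis by auto
  qed
  then have "real m ^ u * \<bar>r (b k) - r (b k')\<bar> \<le> real m ^ N * (real m ^ N * eps)"
    using u m by (intro mult_mono power_increasing) auto
  also have "\<dots> = s / 2"
  proof -
    have "real m ^ (2 * N) = real m ^ N * real m ^ N" by (simp add: mult_2 power_add)
    moreover have "real m ^ N \<noteq> 0" using m by simp
    ultimately show ?thesis unfolding eps_def using m by (simp add: divide_simps)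
  qed
  finally show False using s0 by simp
qed

text \<open>A real label in \<open>[0, 1)\<close> for the tree vertex containing \<open>z\<close> at
  height \<open>b\<close>, by \<open>residue_eq_iff\<close>.\<close>

definition residue :: "nat \<Rightarrow> int \<Rightarrow> real \<Rightarrow> real" where
  "residue n b z = frac (z / real n powi b)"

lemma residue_eq_iff:
  assumes "n > 0"
  shows "residue n b z = residue n b z' \<longleftrightarrow> z - z' \<in> scaled_ints n b"
proof
  assume "residue n b z = residue n b z'"
  then obtain j where "z / real n powi b = z' / real n powi b + of_int j"
    unfolding residue_def by (rule frac_eqE)
  then have "z - z' = of_int j * real n powi b" using assms by (simp add: field_simps)
  then show "z - z' \<in> scaled_ints n b" by (rule scaled_intsI)
next
  assume "z - z' \<in> scaled_ints n b"
  then obtain j where "z - z' = of_int j * real n powi b" by (rule scaled_intsE)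
  then have "z / real n powi b = z' / real n powi b + of_int j" using assms by (simp add: field_simps)
  then show "residue n b z = residue n b z'" by (simp add: residue_def)
qed

text \<open>A vertex at height \<open>b'\<close> has \<open>n ^ nat (b - b')\<close> descendants at
  height \<open>b\<close>.\<close>

lemma card_residues:
  assumes n: "n > 0" and b: "b' \<le> b" and Z: "\<And>z. z \<in> Z \<Longrightarrow> z - z0 \<in> scaled_ints n b'"
  shows "finite (residue n b ` Z)" "card (residue n b ` Z) \<le> n ^ nat (b - b')"
proof -
  define M where "M = n ^ nat (b - b')"
  have nb: "real n powi b = real M * real n powi b'" unfolding M_def by (rule powi_eq_power_mult[OF n b])
  have M: "M > 0" using n by (simp add: M_def)
  have sub: "residue n b ` Z \<subseteq> (\<lambda>t. residue n b (z0 + real t * real n powi b')) ` {..<M}"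
  proof
    fix y assume "y \<in> residue n b ` Z"
    then obtain z where z: "z \<in> Z" "y = residue n b z" by blast
    obtain j where j: "z - z0 = of_int j * real n powi b'" using Z[OF z(1)] by (rule scaled_intsE)
    define t where "t = nat (j mod int M)"
    have t: "t < M" "int t = j mod int M" using M by (auto simp: t_def nat_less_iff)
    have "(of_int j :: real) = of_int (j div int M * int M + j mod int M)" by simp
    also have "\<dots> = of_int (j div int M) * real M + real t"
      unfolding t(2)[symmetric] of_int_add of_int_mult by simp
    finally have "z - (z0 + real t * real n powi b') = of_int (j div int M) * real n powi b"
      using j unfolding nb by (simp add: algebra_simps)
    then have "residue n b z = residue n b (z0 + real t * real n powi b')"
      unfolding residue_eq_iff[OF n] by (rule scaled_intsI)
    with z(2) t(1) show "y \<in> (\<lambda>t. residue n b (z0 + real t * real n powi b')) ` {..<M}" by blast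
  qed
  show "finite (residue n b ` Z)" using sub by (rule finite_subset) simp
  have "card (residue n b ` Z) \<le> card {..<M}" using sub by (intro surj_card_le) auto
  then show "card (residue n b ` Z) \<le> n ^ nat (b - b')" by (simp add: M_def)
qed

section \<open>Image heights and shadows of tree vertices\<close>

context bs_coarse_embedding
begin

definition level :: "int \<Rightarrow> int" where
  "level k = \<lfloor>of_int k * log (real n) (real m)\<rfloor>"

lemma log_nm: "log (real n) (real m) > 0"
  using m2 n2 by simp

lemma level_mono: "k \<le> l \<Longrightarrow> level k \<le> level l"
  unfolding level_def using log_nm by (intro floor_mono mult_right_mono) auto

lemma log_powi: "log (real n) (real m powi k) = of_int k * log (real n) (real m)"
  using m0 by (simp flip: powr_real_of_int')(simp add: log_powr)

text \<open>Take logarithms to base \<open>n\<close> in \<open>height_bound\<close>.\<close>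

lemma level_height:
  "\<exists>q::nat. \<forall>p\<in>bs_points m. \<bar>snd (F p) - level (snd p)\<bar> \<le> int q"
proof -
  obtain Q where Q: "Q > 0" and bd: "\<And>p. p \<in> bs_points m \<Longrightarrow>
      real m powi snd p \<le> Q * real n powi snd (F p) \<and> real n powi snd (F p) \<le> Q * real m powi snd p"
    using height_bound by blast
  have n1: "1 < real n" using n2 by simp
  define q where "q = nat \<lceil>log (real n) Q\<rceil>"
  have q: "log (real n) Q \<le> real q" by (simp add: q_def) linarith
  have ln: "log (real n) (real n powi l) = of_int l" for l
    using n1 by (simp flip: powr_real_of_int')
  have "\<bar>snd (F p) - level (snd p)\<bar> \<le> int q" if p: "p \<in> bs_points m" for p
  proof -
    have "log (real n) (real m powi snd p) \<le> log (real n) (Q * real n powi snd (F p))"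
      using bd[OF p] n1 m0 Q by (subst log_le_cancel_iff) auto
    also have "\<dots> = log (real n) Q + of_int (snd (F p))"
      using n1 Q by (subst log_mult) (auto simp: ln)
    finally have 1: "of_int (snd p) * log (real n) (real m) \<le> log (real n) Q + of_int (snd (F p))"
      by (simp only: log_powi)
    have "log (real n) (real n powi snd (F p)) \<le> log (real n) (Q * real m powi snd p)"
      using bd[OF p] n1 m0 Q by (subst log_le_cancel_iff) auto
    also have "\<dots> = log (real n) Q + of_int (snd p) * log (real n) (real m)"
      using n1 Q m0 by (subst log_mult) (auto simp: log_powi)
    finally have 2: "of_int (snd (F p)) \<le> log (real n) Q + of_int (snd p) * log (real n) (real m)"
      by (simp only: ln)
    show ?thesis using 1 2 q unfolding level_def by linarith
  qed
  then show ?thesis by blast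
qed

end

locale bs_levelled = bs_coarse_embedding +
  fixes q :: nat
  assumes level_height: "p \<in> bs_points m \<Longrightarrow> \<bar>snd (F p) - level (snd p)\<bar> \<le> int q"
begin

text \<open>Along the upward ray the images have height at least \<open>level k - q\<close>, and the
  paths joining them descend at most \<open>L\<close> further. So they all lie over one tree
  vertex.\<close>

lemma vertical_diff:
  assumes p: "(x, k) \<in> bs_points m"
  shows "fst (F (x, k + int d)) - fst (F (x, k)) \<in> scaled_ints n (level k - int (q + L))"
proof (induction d)
  case (Suc d)
  have p': "(x, k + int d) \<in> bs_points m" using p by (rule bs_points_height)
  have "bs_step m (x, k + int d) (x, k + int (Suc d))"
    using bs_step.up[of m x "k + int d"] by (simp add: algebra_simps)
  from near_diff[OF n0 lip[OF p' this]]
  have "fst (F (x, k + int (Suc d))) - fst (F (x, k + int d)) \<in> scaled_ints n (snd (F (x, k + int d)) - int L)" .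
  moreover have "level k - int (q + L) \<le> snd (F (x, k + int d)) - int L"
    using level_height[OF p'] level_mono[of k "k + int d"] by simp
  ultimately have "fst (F (x, k + int (Suc d))) - fst (F (x, k + int d)) \<in> scaled_ints n (level k - int (q + L))"
    using n0 scaled_ints_monoD by blast
  from scaled_ints_diff_trans[OF this Suc] show ?case .
qed simp

text \<open>The constant of \<open>near_of_diff\<close> for images at heights within
  \<open>q\<close> of \<open>level h\<close>, measured from the base height
  \<open>level h - int (q + L + width)\<close>.\<close>

definition close_const :: nat where
  "close_const = 2 * (2 * q + L + width) + stretch * n ^ (2 * q + L + width)"

definition spread :: nat where
  "spread = \<rho> close_const"

text \<open>\<open>shadow x i\<close> is the set of tree vertices at height \<open>target i\<close> lying under the image of the part of
  the source above the vertex \<open>x + m\<^sup>i \<int>\<close>, sampled \<open>spread\<close> levels higher so that shadows of siblings are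
  disjoint.\<close>

definition above :: "real \<Rightarrow> int \<Rightarrow> real set" where
  "above x i = range (\<lambda>s::int. fst (F (x + of_int s * real m powi i, i + int spread)))"

definition target :: "int \<Rightarrow> int" where
  "target i = level (i + int spread) - int (q + L)"

definition shadow :: "real \<Rightarrow> int \<Rightarrow> real set" where
  "shadow x i = residue n (target i) ` above x i"

definition below :: "int \<Rightarrow> int" where
  "below i = level i - int (q + L + width)"

text \<open>Descend from the sample to height \<open>i\<close> by \<open>vertical_diff\<close>, then
  move along the horocycle by \<open>fibre_cone\<close>; height \<open>below i\<close> is low enough
  for both.\<close>

lemma above_diff:
  assumes p: "(x, i) \<in> bs_points m" and z: "z \<in> above x i"
  shows "z - fst (F (x, i)) \<in> scaled_ints n (below i)"
proof -
  obtain s where s: "z = fst (F (x + of_int s * real m powi i, i + int spread))"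
    using z by (auto simp: above_def)
  have "z - fst (F (x + of_int s * real m powi i, i)) \<in> scaled_ints n (level i - int (q + L))"
    unfolding s by (rule vertical_diff[OF fibre_closed[OF p]])
  then have 1: "z - fst (F (x + of_int s * real m powi i, i)) \<in> scaled_ints n (below i)"
    by (rule scaled_ints_monoD[OF _ n0]) (simp add: below_def)
  have "fst (F (x + of_int s * real m powi i, i)) - fst (F (x, i)) \<in> scaled_ints n (snd (F (x, i)) - int width)"
    by (rule coneD(2)[OF fibre_cone[OF p]])
  then have 2: "fst (F (x + of_int s * real m powi i, i)) - fst (F (x, i)) \<in> scaled_ints n (below i)"
    by (rule scaled_ints_monoD[OF _ n0]) (use level_height[OF p] in \<open>simp add: below_def\<close>)
  from scaled_ints_diff_trans[OF 1 2] show ?thesis .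
qed

definition shadow_bound :: nat where
  "shadow_bound = n ^ (nat \<lceil>real spread * log (real n) (real m)\<rceil> + width)"

text \<open>All samples lie over one vertex at height \<open>below i\<close>, and
  \<open>target i - below i\<close> is bounded independently of \<open>x\<close> and
  \<open>i\<close>.\<close>

lemma shadow_card:
  assumes p: "(x, i) \<in> bs_points m"
  shows "finite (shadow x i)" "1 \<le> card (shadow x i)" "card (shadow x i) \<le> shadow_bound"
proof -
  have le: "below i \<le> target i"
    using level_mono[of i "i + int spread"] by (simp add: below_def target_def)
  note card = card_residues[OF n0 le above_diff[OF p], of "above x i"]
  show fin: "finite (shadow x i)" using card(1) by (simp add: shadow_def)
  have "shadow x i \<noteq> {}" by (simp add: shadow_def above_def)
  then show "1 \<le> card (shadow x i)" using fin by (simp add: Suc_leI card_gt_0_iff)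
  have "level (i + int spread) \<le> level i + \<lceil>real spread * log (real n) (real m)\<rceil>"
    unfolding level_def by (simp add: algebra_simps) linarith
  then have "nat (target i - below i) \<le> nat \<lceil>real spread * log (real n) (real m)\<rceil> + width"
    by (simp add: below_def target_def)
  then have "n ^ nat (target i - below i) \<le> shadow_bound"
    unfolding shadow_bound_def using n0 by (intro power_increasing) auto
  with card(2) show "card (shadow x i) \<le> shadow_bound" by (simp add: shadow_def)
qed

lemma child_sum:
  "x + of_int r * real m powi i + of_int s * real m powi (i + 1) = x + of_int (r + s * int m) * real m powi i"
proof -
  have "real m powi (i + 1) = real m * real m powi i" using m0 by (simp add: power_int_add_1')
  then show ?thesis by (simp only:) (simp add: algebra_simps)
qed

text \<open>Suppose the images of \<open>x1\<close> and \<open>x2\<close> at height \<open>h\<close>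
  lie over a common vertex. Since the image of a horocycle is coarsely onto, some \<open>x3\<close>
  on the horocycle of \<open>x1\<close> has image horizontally close to that of \<open>x2\<close>,
  and then close in the target. Properness makes \<open>x2\<close> and \<open>x3\<close> close in
  the source, hence congruent modulo \<open>m\<close> to the power \<open>i + 1\<close>.\<close>

lemma shadow_disjoint:
  assumes p: "(x, i) \<in> bs_points m" and r: "r < m" "r' < m"
    and y: "y \<in> shadow (x + real r * real m powi i) (i + 1)" "y \<in> shadow (x + real r' * real m powi i) (i + 1)"
  shows "r = r'"
proof -
  define h where "h = i + 1 + int spread"
  obtain s where s: "y = residue n (target (i + 1)) (fst (F (x + real r * real m powi i + of_int s * real m powi (i + 1), h)))"
    using y(1) by (auto simp: shadow_def above_def h_def)
  obtain s' where s': "y = residue n (target (i + 1)) (fst (F (x + real r' * real m powi i + of_int s' * real m powi (i + 1), h)))"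
    using y(2) by (auto simp: shadow_def above_def h_def)
  define x1 x2 where "x1 = x + of_int (int r + s * int m) * real m powi i"
    and "x2 = x + of_int (int r' + s' * int m) * real m powi i"
  have x1: "x + real r * real m powi i + of_int s * real m powi (i + 1) = x1"
    unfolding x1_def using child_sum[of x "int r"] by simp
  have x2: "x + real r' * real m powi i + of_int s' * real m powi (i + 1) = x2"
    unfolding x2_def using child_sum[of x "int r'"] by simp
  have p1: "(x1, h) \<in> bs_points m" unfolding x1_def by (rule bs_points_height[OF fibre_closed[OF p]])
  have p2: "(x2, h) \<in> bs_points m" unfolding x2_def by (rule bs_points_height[OF fibre_closed[OF p]])
  obtain j where j: "\<bar>fst (F (x1 + of_int j * real m powi h, h)) - fst (F (x2, h))\<bar>
      \<le> real stretch * real n powi snd (F (x1, h))"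
    using fibre_onto[OF p1] by blast
  define x3 where "x3 = x1 + of_int j * real m powi h"
  have p3: "(x3, h) \<in> bs_points m" unfolding x3_def by (rule fibre_closed[OF p1])
  define b where "b = level h - int (q + L + width)"
  have "fst (F (x1, h)) - fst (F (x2, h)) \<in> scaled_ints n (target (i + 1))"
    using s s' residue_eq_iff[OF n0] unfolding x1 x2 by metis
  then have d1: "fst (F (x1, h)) - fst (F (x2, h)) \<in> scaled_ints n b"
    by (rule scaled_ints_monoD[OF _ n0]) (simp add: b_def target_def h_def)
  have "fst (F (x3, h)) - fst (F (x1, h)) \<in> scaled_ints n (snd (F (x1, h)) - int width)"
    unfolding x3_def by (rule coneD(2)[OF fibre_cone[OF p1]])
  then have d2: "fst (F (x3, h)) - fst (F (x1, h)) \<in> scaled_ints n b"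
    by (rule scaled_ints_monoD[OF _ n0]) (use level_height[OF p1] in \<open>simp add: b_def\<close>)
  have "near n close_const (F (x2, h)) (F (x3, h))"
    unfolding close_const_def
  proof (rule near_of_diff[OF n0, where b = b])
    show "fst (F (x3, h)) - fst (F (x2, h)) \<in> scaled_ints n b"
      by (rule scaled_ints_diff_trans[OF d2 d1])
    have "\<bar>fst (F (x3, h)) - fst (F (x2, h))\<bar> \<le> real stretch * real n powi (b + int (2 * q + L + width))"
    proof -
      have "real stretch * real n powi snd (F (x1, h)) \<le> real stretch * real n powi (b + int (2 * q + L + width))"
        using level_height[OF p1] n0 by (intro mult_left_mono power_int_increasing) (auto simp: b_def)
      with j show ?thesis unfolding x3_def by linarith
    qed
    then show "\<bar>fst (F (x3, h)) - fst (F (x2, h))\<bar> \<le> real (stretch * n ^ (2 * q + L + width)) * real n powi b"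
      unfolding powi_add_nat[OF n0] by simp
  qed (use level_height[OF p2] level_height[OF p3] in \<open>auto simp: b_def\<close>)
  then have "near m spread (x2, h) (x3, h)" unfolding spread_def by (rule proper[OF p2 p3])
  \<comment> \<open>A path of length \<open>spread\<close> from height \<open>h\<close> reaches down
    to \<open>h - spread = i + 1\<close> at most.\<close>
  from near_diff[OF m0 this] have x32: "x3 - x2 \<in> scaled_ints m (i + int 1)" by (simp add: h_def)
  have "real m powi h = real m ^ (1 + spread) * real m powi i"
    using powi_add_nat[OF m0, of i "1 + spread"] by (simp add: h_def algebra_simps)
  then have "x3 - x2 = of_int (int r - int r' + (s - s') * int m + j * int m ^ (1 + spread)) * real m powi i"
    by (simp add: x3_def x1_def x2_def algebra_simps)
  with x32 have "int m ^ 1 dvd int r - int r' + (s - s') * int m + j * int m ^ (1 + spread)"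
    by (intro of_int_powi_mem_scaled_ints_dvd[OF m0, of _ i 1]) simp
  then have "int m dvd int r - int r' + ((s - s') + j * int m ^ spread) * int m"
    by (simp add: algebra_simps)
  then have "int m dvd int r - int r'" by (simp only: dvd_add_times_triv_right_iff)
  then show "r = r'" using r by (simp add: mod_eq_dvd_iff[symmetric])
qed

text \<open>The shadows of the children are disjoint, and all their vertices lie above vertices of
  \<open>shadow x i\<close>.\<close>

lemma shadow_refine:
  assumes p: "(x, i) \<in> bs_points m"
  shows "(\<Sum>r<m. card (shadow (x + real r * real m powi i) (i + 1))) \<le>
    n ^ nat (target (i + 1) - target i) * card (shadow x i)"
proof -
  have tle: "target i \<le> target (i + 1)"
    unfolding target_def using level_mono[of "i + int spread" "i + 1 + int spread"] by simp
  have pr: "(x + real r * real m powi i, i + 1) \<in> bs_points m" for r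
    using bs_points_height[OF fibre_closed[OF p, of "int r"]] by simp
  define slice where "slice y = residue n (target (i + 1)) ` {z. residue n (target i) z = y}" for y
  have slice: "finite (slice y) \<and> card (slice y) \<le> n ^ nat (target (i + 1) - target i)"
    if "y \<in> shadow x i" for y
  proof -
    obtain z0 where z0: "y = residue n (target i) z0" using \<open>y \<in> shadow x i\<close> by (auto simp: shadow_def)
    have "z - z0 \<in> scaled_ints n (target i)" if "z \<in> {z. residue n (target i) z = y}" for z
      using that unfolding z0 by (simp add: residue_eq_iff[OF n0])
    from card_residues[OF n0 tle this] show ?thesis unfolding slice_def by blast
  qed
  have "(\<Sum>r<m. card (shadow (x + real r * real m powi i) (i + 1))) =
      card (\<Union>r<m. shadow (x + real r * real m powi i) (i + 1))"
    by (rule card_UN_disjoint[symmetric]) (use shadow_card(1)[OF pr] shadow_disjoint[OF p] in auto)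
  also have "\<dots> \<le> card (\<Union>y\<in>shadow x i. slice y)"
  proof (rule card_mono)
    show "finite (\<Union>y\<in>shadow x i. slice y)" using shadow_card(1)[OF p] slice by blast
    show "(\<Union>r<m. shadow (x + real r * real m powi i) (i + 1)) \<subseteq> (\<Union>y\<in>shadow x i. slice y)"
    proof
      fix y assume "y \<in> (\<Union>r<m. shadow (x + real r * real m powi i) (i + 1))"
      then obtain r s where y: "y = residue n (target (i + 1))
          (fst (F (x + real r * real m powi i + of_int s * real m powi (i + 1), i + 1 + int spread)))"
        by (auto simp: shadow_def above_def)
      define x' where "x' = x + of_int (int r + s * int m) * real m powi i"
      have x': "x + real r * real m powi i + of_int s * real m powi (i + 1) = x'"
        unfolding x'_def using child_sum[of x "int r"] by simp
      have "(x', i + int spread) \<in> bs_points m"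
        unfolding x'_def by (rule bs_points_height[OF fibre_closed[OF p]])
      \<comment> \<open>Raising the sample by one level keeps its image over the same vertex at
        height \<open>target i\<close>, and the lower sample belongs to
        \<open>above x i\<close>.\<close>
      from vertical_diff[OF this, of 1]
      have "residue n (target i) (fst (F (x', i + 1 + int spread))) = residue n (target i) (fst (F (x', i + int spread)))"
        by (simp add: residue_eq_iff[OF n0] target_def algebra_simps)
      moreover have "residue n (target i) (fst (F (x', i + int spread))) \<in> shadow x i"
        unfolding shadow_def above_def x'_def by blast
      ultimately show "y \<in> (\<Union>y\<in>shadow x i. slice y)" unfolding y x' slice_def by blast
    qed
  qed
  also have "\<dots> \<le> (\<Sum>y\<in>shadow x i. card (slice y))"
    using shadow_card(1)[OF p] by (rule card_UN_le)
  also have "\<dots> \<le> (\<Sum>y\<in>shadow x i. n ^ nat (target (i + 1) - target i))"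
    using slice by (intro sum_mono) blast
  finally show ?thesis by (simp add: mult.commute)
qed

text \<open>This keeps the normalised counts bounded away from \<open>0\<close>.\<close>

lemma target_bound: "real n powi target i \<le> real m ^ spread * real m powi i"
proof -
  have n1: "1 < real n" using n2 by simp
  have "real n powi target i \<le> real n powi level (i + int spread)"
    using n1 by (intro power_int_increasing) (auto simp: target_def)
  also have "\<dots> = real n powr of_int (level (i + int spread))"
    using n1 by (simp add: powr_real_of_int')
  also have "\<dots> \<le> real n powr log (real n) (real m powi (i + int spread))"
    unfolding log_powi level_def using n1 by (intro powr_mono) auto
  also have "\<dots> = real m powi (i + int spread)" using n1 m0 by (intro powr_log_cancel) auto
  finally show ?thesis by (simp only: powi_add_nat[OF m0])
qed

lemma common_power: "powers_of_common_integer m n"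
proof -
  have "\<exists>u w. u > 0 \<and> m ^ u = n ^ w"
  \<comment> \<open>A tree vertex is represented by any point \<open>(x, i)\<close> over it, and its
    children are indexed by the next digit \<open>r < m\<close>.\<close>
  proof (rule power_eq_of_branching_counts[where V = "bs_points m" and base = "(0, 0)" and ht = snd and J = target
        and child = "\<lambda>v r. (fst v + real r * real m powi snd v, snd v + 1)"
        and a = "\<lambda>v. card (shadow (fst v) (snd v))" and N = shadow_bound and c = "real m ^ spread"])
    show "(0, 0) \<in> bs_points m" by (auto simp: bs_points_def)
    show "(fst v + real i * real m powi snd v, snd v + 1) \<in> bs_points m" if "v \<in> bs_points m" for v i
      using that bs_points_height[OF fibre_closed[of "fst v" "snd v" "int i"]] by simp
    show "target i \<le> target (i + 1)" for i
      unfolding target_def using level_mono[of "i + int spread" "i + 1 + int spread"] by simp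
    show "(\<Sum>i<m. card (shadow (fst (fst v + real i * real m powi snd v, snd v + 1)) (snd (fst v + real i * real m powi snd v, snd v + 1)))) \<le>
        n ^ nat (target (snd v + 1) - target (snd v)) * card (shadow (fst v) (snd v))" if "v \<in> bs_points m" for v
      using shadow_refine[of "fst v" "snd v"] that by simp
    show "1 \<le> card (shadow (fst v) (snd v))" "card (shadow (fst v) (snd v)) \<le> shadow_bound"
      if "v \<in> bs_points m" for v
      using shadow_card(2,3)[of "fst v" "snd v"] that by simp_all
  qed (simp_all add: m0 n0 target_bound)
  then show ?thesis using powers_of_common_integerI m2 n2 by blast
qed

end

theorem (in bs_coarse_embedding) source_target_common_power: "powers_of_common_integer m n"
proof -
  obtain q :: nat where "\<forall>p\<in>bs_points m. \<bar>snd (F p) - level (snd p)\<bar> \<le> int q"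
    using level_height by blast
  then interpret bs_levelled m n L \<rho> F q by unfold_locales blast
  show ?thesis by (rule common_power)
qed

section \<open>The Cayley graph of the presented group\<close>

text \<open>Right multiplication in affine coordinates: \<open>a\<close> is the translation by
  \<open>1\<close> and \<open>t\<close> the multiplication by \<open>m\<close>, each applied before
  the map given by \<open>p\<close>.\<close>

fun letter_act :: "nat \<Rightarrow> pt \<Rightarrow> bs_gen \<times> bool \<Rightarrow> pt" where
  "letter_act m p (Gen_a, False) = (fst p + real m powi snd p, snd p)"
| "letter_act m p (Gen_a, True) = (fst p - real m powi snd p, snd p)"
| "letter_act m p (Gen_t, False) = (fst p, snd p + 1)"
| "letter_act m p (Gen_t, True) = (fst p, snd p - 1)"

definition word_act :: "nat \<Rightarrow> pt \<Rightarrow> bs_gen word \<Rightarrow> pt" where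
  "word_act m p w = foldl (letter_act m) p w"

lemma word_act_simps [simp]:
  "word_act m p [] = p" "word_act m p (l # w) = word_act m (letter_act m p l) w"
  "word_act m p (u @ v) = word_act m (word_act m p u) v"
  by (simp_all add: word_act_def)

lemma letter_act_step: "bs_step m p (letter_act m p l)"
  using bs_step.right[of m "fst p" "snd p"] bs_step.left[of m "fst p" "snd p"]
    bs_step.up[of m "fst p" "snd p"] bs_step.down[of m "fst p" "snd p"]
  by (cases "(m, p, l)" rule: letter_act.cases) auto

lemma step_letter_act: "bs_step m p q \<Longrightarrow> \<exists>l. q = letter_act m p l"
proof (induction rule: bs_step.induct)
  case (right x k) show ?case by (rule exI[of _ "(Gen_a, False)"]) simp
next
  case (left x k) show ?case by (rule exI[of _ "(Gen_a, True)"]) simp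
next
  case (up x k) show ?case by (rule exI[of _ "(Gen_t, False)"]) simp
next
  case (down x k) show ?case by (rule exI[of _ "(Gen_t, True)"]) simp
qed

lemma near_word_act: "near m (length w) p (word_act m p w)"
proof (induction w rule: rev_induct)
  case (snoc l w)
  from near.step[OF snoc letter_act_step] show ?case by simp
qed (simp add: near.refl)

lemma near_obtain_word: "near m N p q \<Longrightarrow> \<exists>w. length w \<le> N \<and> word_act m p w = q"
proof (induction rule: near.induct)
  case (refl N p) show ?case by (rule exI[of _ "[]"]) simp
next
  case (step N p q r)
  then obtain w l where "length w \<le> N" "word_act m p w = q" "r = letter_act m q l"
    using step_letter_act by metis
  then show ?case by (intro exI[of _ "w @ [l]"]) simp
qed

lemma word_act_replicate_a: "word_act m p (replicate N (Gen_a, True)) = (fst p - real N * real m powi snd p, snd p)"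
  by (induction N arbitrary: p) (simp_all add: algebra_simps)

lemma word_act_relator: "m > 0 \<Longrightarrow> word_act m p (BS_relator m) = p"
  by (simp add: BS_relator_def word_act_replicate_a power_int_add_1')

lemma word_act_pres_eq:
  assumes "m > 0"
  shows "pres_eq {BS_relator m} u v \<Longrightarrow> word_act m p u = word_act m p v"
proof (induction arbitrary: p rule: pres_eq.induct)
  case (cancel u x b v)
  have "letter_act m (letter_act m q (x, b)) (x, \<not> b) = q" for q
    by (cases x; cases b) auto
  then show ?case by simp
qed (auto simp: word_act_relator[OF assms])

text \<open>By \<open>word_act_pres_eq\<close> the value is independent of the chosen
  representative.\<close>

definition bs_act :: "nat \<Rightarrow> pt \<Rightarrow> bs_gen word set \<Rightarrow> pt" where
  "bs_act m p X = word_act m p (SOME w. w \<in> X)"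

lemma bs_act_word_class:
  assumes "m > 0"
  shows "bs_act m p (word_class {BS_relator m} w) = word_act m p w"
proof -
  have "(SOME v. v \<in> word_class {BS_relator m} w) \<in> word_class {BS_relator m} w"
    by (rule someI[of _ w]) (simp add: word_class_def pres_eq.refl)
  then have "pres_eq {BS_relator m} w (SOME v. v \<in> word_class {BS_relator m} w)"
    by (simp add: word_class_def)
  from word_act_pres_eq[OF assms this] show ?thesis by (simp add: bs_act_def)
qed

lemma carrier_BS: "carrier (BS m) = range (word_class {BS_relator m})"
  by (simp add: BS_def carrier_presented_group)

definition coord :: "nat \<Rightarrow> bs_gen word set \<Rightarrow> pt" where
  "coord m X = bs_act m (0, 0) X"

section \<open>Normal forms and the simply transitive affine action\<close>

locale bs_group =
  fixes m :: nat
  assumes m0: "m > 0"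
begin

sublocale group "BS m" by (rule group_BS)

abbreviation "G \<equiv> BS m"
abbreviation "a \<equiv> BS_gen m Gen_a"
abbreviation "t \<equiv> BS_gen m Gen_t"

lemma gens [simp]: "a \<in> carrier G" "t \<in> carrier G" by (rule BS_gen_closed)+

lemma bs_act_mult:
  assumes "X \<in> carrier G" "Y \<in> carrier G"
  shows "bs_act m p (X \<otimes>\<^bsub>G\<^esub> Y) = bs_act m (bs_act m p X) Y"
proof -
  obtain u v where uv: "X = word_class {BS_relator m} u" "Y = word_class {BS_relator m} v"
    using assms by (auto simp: carrier_BS)
  then show ?thesis unfolding BS_def uv mult_word_class by (simp add: bs_act_word_class[OF m0])
qed

lemma bs_act_one: "bs_act m p \<one>\<^bsub>G\<^esub> = p"
  unfolding BS_def one_presented_group by (simp add: bs_act_word_class[OF m0])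

lemma bs_act_inv: "X \<in> carrier G \<Longrightarrow> bs_act m (bs_act m p (inv\<^bsub>G\<^esub> X)) X = p"
  using bs_act_mult[of "inv\<^bsub>G\<^esub> X" X p] by (simp add: bs_act_one)

lemma bs_act_gens: "bs_act m p a = (fst p + real m powi snd p, snd p)" "bs_act m p t = (fst p, snd p + 1)"
  by (simp_all add: BS_gen_def bs_act_word_class[OF m0])

lemma bs_act_t_nat: "bs_act m p (t [^]\<^bsub>G\<^esub> (i::nat)) = (fst p, snd p + int i)"
  by (induction i arbitrary: p) (auto simp: bs_act_one bs_act_mult bs_act_gens)

lemma bs_act_a_nat: "bs_act m p (a [^]\<^bsub>G\<^esub> (j::nat)) = (fst p + real j * real m powi snd p, snd p)"
  by (induction j arbitrary: p) (auto simp: bs_act_one bs_act_mult bs_act_gens algebra_simps)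

lemma bs_act_t: "bs_act m p (t [^]\<^bsub>G\<^esub> (i::int)) = (fst p, snd p + i)"
proof (cases i rule: int_cases2)
  case (nonneg k) then show ?thesis by (simp add: int_pow_int bs_act_t_nat)
next
  case (nonpos k)
  define q where "q = bs_act m p (inv\<^bsub>G\<^esub> (t [^]\<^bsub>G\<^esub> k))"
  have "bs_act m q (t [^]\<^bsub>G\<^esub> k) = p" unfolding q_def by (rule bs_act_inv) simp
  then have "q = (fst p, snd p - int k)" by (auto simp: bs_act_t_nat)
  then show ?thesis using nonpos by (simp add: int_pow_neg_int q_def)
qed

lemma bs_act_a: "bs_act m p (a [^]\<^bsub>G\<^esub> (j::int)) = (fst p + of_int j * real m powi snd p, snd p)"
proof (cases j rule: int_cases2)
  case (nonneg k) then show ?thesis by (simp add: int_pow_int bs_act_a_nat)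
next
  case (nonpos k)
  define q where "q = bs_act m p (inv\<^bsub>G\<^esub> (a [^]\<^bsub>G\<^esub> k))"
  have "bs_act m q (a [^]\<^bsub>G\<^esub> k) = p" unfolding q_def by (rule bs_act_inv) simp
  then have "q = (fst p - real k * real m powi snd p, snd p)" by (auto simp: bs_act_a_nat)
  then show ?thesis using nonpos by (simp add: int_pow_neg_int q_def)
qed

text \<open>Conjugation by \<open>t\<close> is multiplicative, so \<open>BS_relation\<close> extends
  to natural powers of \<open>a\<close>; inverses give the negative ones.\<close>

lemma t_a_int: "t \<otimes>\<^bsub>G\<^esub> a [^]\<^bsub>G\<^esub> (j::int) = a [^]\<^bsub>G\<^esub> (j * int m) \<otimes>\<^bsub>G\<^esub> t"
proof -
  have conj: "t \<otimes>\<^bsub>G\<^esub> a [^]\<^bsub>G\<^esub> k \<otimes>\<^bsub>G\<^esub> inv\<^bsub>G\<^esub> t = (a [^]\<^bsub>G\<^esub> m) [^]\<^bsub>G\<^esub> k" for k :: nat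
  proof (induction k)
    case (Suc k)
    have "t \<otimes>\<^bsub>G\<^esub> a [^]\<^bsub>G\<^esub> Suc k \<otimes>\<^bsub>G\<^esub> inv\<^bsub>G\<^esub> t =
        (t \<otimes>\<^bsub>G\<^esub> a [^]\<^bsub>G\<^esub> k \<otimes>\<^bsub>G\<^esub> inv\<^bsub>G\<^esub> t) \<otimes>\<^bsub>G\<^esub> (t \<otimes>\<^bsub>G\<^esub> a \<otimes>\<^bsub>G\<^esub> inv\<^bsub>G\<^esub> t)"
      by (simp add: m_assoc inv_solve_left)
    then show ?case unfolding Suc BS_relation by simp
  qed simp
  have nat: "t \<otimes>\<^bsub>G\<^esub> a [^]\<^bsub>G\<^esub> k = a [^]\<^bsub>G\<^esub> (k * m) \<otimes>\<^bsub>G\<^esub> t" for k :: nat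
    using conj[of k] by (simp add: nat_pow_pow mult.commute inv_solve_right')
  show ?thesis
  proof (cases j rule: int_cases2)
    case (nonneg k)
    then show ?thesis using nat[of k] by (simp add: int_pow_int flip: of_nat_mult)
  next
    case (nonpos k)
    have "inv\<^bsub>G\<^esub> (a [^]\<^bsub>G\<^esub> (k * m)) \<otimes>\<^bsub>G\<^esub> (t \<otimes>\<^bsub>G\<^esub> a [^]\<^bsub>G\<^esub> k) = t"
      unfolding nat by (simp add: m_assoc[symmetric])
    then have "inv\<^bsub>G\<^esub> (a [^]\<^bsub>G\<^esub> (k * m)) \<otimes>\<^bsub>G\<^esub> t = t \<otimes>\<^bsub>G\<^esub> inv\<^bsub>G\<^esub> (a [^]\<^bsub>G\<^esub> k)"
      by (simp add: inv_solve_right m_assoc[symmetric])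
    then show ?thesis using nonpos by (simp add: int_pow_neg_int flip: of_nat_mult)
  qed
qed

lemma t_pow_a_int:
  "t [^]\<^bsub>G\<^esub> (l::nat) \<otimes>\<^bsub>G\<^esub> a [^]\<^bsub>G\<^esub> (j::int) = a [^]\<^bsub>G\<^esub> (j * int m ^ l) \<otimes>\<^bsub>G\<^esub> t [^]\<^bsub>G\<^esub> l"
proof (induction l arbitrary: j)
  case (Suc l)
  have "t [^]\<^bsub>G\<^esub> Suc l \<otimes>\<^bsub>G\<^esub> a [^]\<^bsub>G\<^esub> j = t [^]\<^bsub>G\<^esub> l \<otimes>\<^bsub>G\<^esub> (t \<otimes>\<^bsub>G\<^esub> a [^]\<^bsub>G\<^esub> j)"
    by (simp add: m_assoc)
  also have "\<dots> = (t [^]\<^bsub>G\<^esub> l \<otimes>\<^bsub>G\<^esub> a [^]\<^bsub>G\<^esub> (j * int m)) \<otimes>\<^bsub>G\<^esub> t"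
    unfolding t_a_int by (simp add: m_assoc)
  also have "\<dots> = a [^]\<^bsub>G\<^esub> (j * int m ^ Suc l) \<otimes>\<^bsub>G\<^esub> t [^]\<^bsub>G\<^esub> Suc l"
    unfolding Suc by (simp add: m_assoc mult_ac)
  finally show ?case .
qed simp

text \<open>Powers of \<open>a\<close> move left past nonnegative powers of \<open>t\<close> at the
  cost of a factor \<open>m ^ l\<close>; for this reason the last exponent is a natural number and
  only the first may be negative.\<close>

definition normal_form :: "int \<Rightarrow> int \<Rightarrow> nat \<Rightarrow> bs_gen word set" where
  "normal_form i j l = t [^]\<^bsub>G\<^esub> i \<otimes>\<^bsub>G\<^esub> a [^]\<^bsub>G\<^esub> j \<otimes>\<^bsub>G\<^esub> t [^]\<^bsub>G\<^esub> l"

lemma normal_form_mult_a: "normal_form i j l \<otimes>\<^bsub>G\<^esub> a [^]\<^bsub>G\<^esub> (e::int) = normal_form i (j + e * int m ^ l) l"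
  unfolding normal_form_def by (simp add: m_assoc t_pow_a_int int_pow_mult)

lemma normal_form_mult_t: "normal_form i j l \<otimes>\<^bsub>G\<^esub> t = normal_form i j (Suc l)"
  unfolding normal_form_def by (simp add: m_assoc)

lemma normal_form_mult_inv_t:
  "normal_form i j l \<otimes>\<^bsub>G\<^esub> inv\<^bsub>G\<^esub> t = (case l of 0 \<Rightarrow> normal_form (i - 1) (j * int m) 0 | Suc l' \<Rightarrow> normal_form i j l')"
proof (cases l)
  case 0
  have "a [^]\<^bsub>G\<^esub> j \<otimes>\<^bsub>G\<^esub> inv\<^bsub>G\<^esub> t = inv\<^bsub>G\<^esub> t \<otimes>\<^bsub>G\<^esub> a [^]\<^bsub>G\<^esub> (j * int m)"
  proof -
    have "inv\<^bsub>G\<^esub> t \<otimes>\<^bsub>G\<^esub> (t \<otimes>\<^bsub>G\<^esub> a [^]\<^bsub>G\<^esub> j \<otimes>\<^bsub>G\<^esub> inv\<^bsub>G\<^esub> t) = a [^]\<^bsub>G\<^esub> j \<otimes>\<^bsub>G\<^esub> inv\<^bsub>G\<^esub> t"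
      by (simp add: m_assoc[symmetric])
    moreover have "t \<otimes>\<^bsub>G\<^esub> a [^]\<^bsub>G\<^esub> j \<otimes>\<^bsub>G\<^esub> inv\<^bsub>G\<^esub> t = a [^]\<^bsub>G\<^esub> (j * int m)"
      unfolding t_a_int by (simp add: m_assoc)
    ultimately show ?thesis by simp
  qed
  moreover have "t [^]\<^bsub>G\<^esub> (i - 1) = t [^]\<^bsub>G\<^esub> i \<otimes>\<^bsub>G\<^esub> inv\<^bsub>G\<^esub> t"
    using int_pow_diff[of t i 1] by simp
  ultimately show ?thesis unfolding normal_form_def using 0 by (simp add: m_assoc)
next
  case (Suc l')
  then show ?thesis unfolding normal_form_def by (simp add: m_assoc)
qed

lemma word_class_normal_form: "\<exists>i j l. word_class {BS_relator m} w = normal_form i j l"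
proof (induction w rule: rev_induct)
  case Nil
  have "word_class {BS_relator m} [] = \<one>\<^bsub>G\<^esub>" by (simp add: BS_def one_presented_group)
  then have "word_class {BS_relator m} [] = normal_form 0 0 0" by (simp add: normal_form_def)
  then show ?case by blast
next
  case (snoc g w)
  then obtain i j l where nf: "word_class {BS_relator m} w = normal_form i j l" by blast
  obtain x b where g: "g = (x, b)" by (cases g)
  have "word_class {BS_relator m} (w @ [g]) = normal_form i j l \<otimes>\<^bsub>G\<^esub> word_class {BS_relator m} [g]"
    unfolding nf[symmetric] BS_def mult_word_class ..
  moreover have "word_class {BS_relator m} [g] = (if b then inv\<^bsub>G\<^esub> (BS_gen m x) else BS_gen m x)"
    unfolding g BS_gen_def BS_def inv_word_class by (simp add: word_inv_def)
  moreover have "inv\<^bsub>G\<^esub> a = a [^]\<^bsub>G\<^esub> (-1::int)" "a = a [^]\<^bsub>G\<^esub> (1::int)"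
    by (simp_all add: int_pow_neg)
  ultimately show ?case
    using normal_form_mult_a[of i j l "-1"] normal_form_mult_a[of i j l 1]
      normal_form_mult_t[of i j l] normal_form_mult_inv_t[of i j l]
    by (cases x; cases b; cases l) (simp_all, blast+)
qed

lemma coord_normal_form: "coord m (normal_form i j l) = (of_int j * real m powi i, i + int l)"
  unfolding coord_def normal_form_def by (simp add: bs_act_mult bs_act_t bs_act_a bs_act_t_nat)

lemma normal_form_closed: "normal_form i j l \<in> carrier G"
  by (simp add: normal_form_def)

text \<open>Faithfulness: for a normal form, trivial coordinates force \<open>j = 0\<close> and
  \<open>i = - int l\<close>.\<close>

lemma coord_eq_0: "X \<in> carrier G \<Longrightarrow> coord m X = (0, 0) \<Longrightarrow> X = \<one>\<^bsub>G\<^esub>"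
proof -
  assume "X \<in> carrier G" "coord m X = (0, 0)"
  then obtain i j l where X: "X = normal_form i j l" "coord m (normal_form i j l) = (0, 0)"
    using word_class_normal_form by (fastforce simp: carrier_BS)
  then have "j = 0" "i = - int l" using m0 by (auto simp: coord_normal_form)
  then show "X = \<one>\<^bsub>G\<^esub>" unfolding X(1) normal_form_def by (simp add: int_pow_neg_int)
qed

lemma coord_mult: "X \<in> carrier G \<Longrightarrow> Y \<in> carrier G \<Longrightarrow> coord m (X \<otimes>\<^bsub>G\<^esub> Y) = bs_act m (coord m X) Y"
  by (simp add: coord_def bs_act_mult)

lemma coord_inj: "inj_on (coord m) (carrier G)"
proof (rule inj_onI)
  fix X Y assume XY: "X \<in> carrier G" "Y \<in> carrier G" "coord m X = coord m Y"
  then have "coord m (X \<otimes>\<^bsub>G\<^esub> inv\<^bsub>G\<^esub> Y) = coord m (Y \<otimes>\<^bsub>G\<^esub> inv\<^bsub>G\<^esub> Y)"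
    by (simp only: coord_mult inv_closed)
  also have "\<dots> = (0, 0)" using XY by (simp add: coord_def bs_act_one)
  finally have "X \<otimes>\<^bsub>G\<^esub> inv\<^bsub>G\<^esub> Y = \<one>\<^bsub>G\<^esub>" using coord_eq_0 XY by simp
  then show "X = Y" using XY by (metis inv_closed inv_equality inv_inv)
qed

lemma coord_image: "coord m ` carrier G = bs_points m"
proof
  show "coord m ` carrier G \<subseteq> bs_points m"
  proof
    fix p assume "p \<in> coord m ` carrier G"
    then obtain w where "p = word_act m (0, 0) w"
      by (auto simp: carrier_BS coord_def bs_act_word_class[OF m0])
    moreover have "(0, 0) \<in> bs_points m" by (auto simp: bs_points_def)
    ultimately show "p \<in> bs_points m" using near_bs_points[OF m0 near_word_act] by blast
  qed
  show "bs_points m \<subseteq> coord m ` carrier G"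
  proof
    fix p assume "p \<in> bs_points m"
    then obtain b where b: "b \<le> snd p" "fst p \<in> scaled_ints m b"
      using bs_points_iff[OF m0, of p "snd p"] by blast
    obtain j where "fst p = of_int j * real m powi b" using b(2) by (rule scaled_intsE)
    then have "p = coord m (normal_form b j (nat (snd p - b)))"
      using b(1) by (simp add: coord_normal_form prod_eq_iff)
    then show "p \<in> coord m ` carrier G" using normal_form_closed by blast
  qed
qed

text \<open>A path from \<open>coord m X\<close> spells a word in the letters \<open>a\<close>,
  \<open>t\<close> and their inverses; since \<open>coord\<close> is injective, this word represents
  the quotient of the two elements.\<close>

lemma word_length_le_near:
  assumes S: "finite_generating_set G S"
  shows "\<exists>c. \<forall>X\<in>carrier G. \<forall>Y\<in>carrier G. \<forall>N. near m N (coord m X) (coord m Y) \<longrightarrow>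
    word_length G S (inv\<^bsub>G\<^esub> X \<otimes>\<^bsub>G\<^esub> Y) \<le> c * N"
proof -
  let ?R = "{BS_relator m}"
  \<comment> \<open>A sum over the four letters, used as an upper bound for each of their
    lengths.\<close>
  define c where "c = (\<Sum>x\<leftarrow>[Gen_a, Gen_t]. \<Sum>b\<leftarrow>[True, False]. word_length G S (word_class ?R [(x, b)]))"
  have letter: "word_length G S (word_class ?R [g]) \<le> c" for g
  proof -
    obtain x b where "g = (x, b)" by (cases g)
    then show ?thesis by (cases x; cases b) (simp_all add: c_def)
  qed
  have clo: "word_class ?R w \<in> carrier G" for w by (simp add: carrier_BS)
  have word: "word_length G S (word_class ?R w) \<le> c * length w" for w
  proof (induction w)
    case Nil
    have "word_class ?R [] = \<one>\<^bsub>G\<^esub>" by (simp add: BS_def one_presented_group)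
    then show ?case using word_length_eq_0_iff[OF S] by simp
  next
    case (Cons g w)
    have "word_class ?R (g # w) = word_class ?R [g] \<otimes>\<^bsub>G\<^esub> word_class ?R w"
      unfolding BS_def mult_word_class by simp
    then have "word_length G S (word_class ?R (g # w)) \<le> word_length G S (word_class ?R [g]) + word_length G S (word_class ?R w)"
      using word_length_mult_le[OF S clo clo] by simp
    also have "\<dots> \<le> c + c * length w" by (intro add_mono letter Cons)
    finally show ?case by simp
  qed
  have "word_length G S (inv\<^bsub>G\<^esub> X \<otimes>\<^bsub>G\<^esub> Y) \<le> c * N"
    if X: "X \<in> carrier G" and Y: "Y \<in> carrier G" and "near m N (coord m X) (coord m Y)" for X Y N
  proof -
    from near_obtain_word[OF that(3)] obtain w where
      w: "length w \<le> N" "word_act m (coord m X) w = coord m Y" by blast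
    then have "coord m (X \<otimes>\<^bsub>G\<^esub> word_class ?R w) = coord m Y"
      by (simp add: coord_mult X clo bs_act_word_class[OF m0])
    then have "X \<otimes>\<^bsub>G\<^esub> word_class ?R w = Y"
      using coord_inj X Y clo by (auto dest: inj_onD)
    then have "inv\<^bsub>G\<^esub> X \<otimes>\<^bsub>G\<^esub> Y = word_class ?R w" using X Y clo by (auto simp: m_assoc[symmetric])
    then show ?thesis using word[of w] w(1) by (metis le_trans mult_le_mono2)
  qed
  then show ?thesis by blast
qed

text \<open>Each of the finitely many generators is a word in \<open>a\<close> and \<open>t\<close>,
  hence moves every point of the affine model a bounded distance.\<close>

lemma near_word_length:
  assumes S: "finite_generating_set G S"
  shows "\<exists>c. \<forall>X\<in>carrier G. \<forall>Y\<in>carrier G. \<forall>N. word_length G S (inv\<^bsub>G\<^esub> X \<otimes>\<^bsub>G\<^esub> Y) \<le> N \<longrightarrow>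
    near m (c * N) (coord m X) (coord m Y)"
proof -
  define S' where "S' = S \<union> m_inv G ` S"
  have fin: "finite S'" and S'G: "S' \<subseteq> carrier G"
    using S by (auto simp: S'_def finite_generating_set_def)
  have "\<forall>s\<in>S'. \<exists>c. \<forall>p. near m c p (bs_act m p s)"
  proof
    fix s assume "s \<in> S'"
    then obtain w where "s = word_class {BS_relator m} w" using S'G by (auto simp: carrier_BS)
    then have "\<forall>p. near m (length w) p (bs_act m p s)"
      using near_word_act by (simp add: bs_act_word_class[OF m0])
    then show "\<exists>c. \<forall>p. near m c p (bs_act m p s)" by blast
  qed
  then obtain f where f: "\<And>s p. s \<in> S' \<Longrightarrow> near m (f s) p (bs_act m p s)" by metis
  define c where "c = sum f S'"
  have c: "near m c p (bs_act m p s)" if "s \<in> S'" for s p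
    by (rule near_mono[OF f[OF that]]) (use fin that in \<open>auto simp: c_def intro: member_le_sum\<close>)
  have path: "set xs \<subseteq> S' \<Longrightarrow> near m (c * length xs) p (bs_act m p (foldr (mult G) xs \<one>\<^bsub>G\<^esub>))" for xs p
  proof (induction xs arbitrary: p)
    case Nil then show ?case by (simp add: bs_act_one near.refl)
  next
    case (Cons s xs)
    then have "s \<in> S'" "set xs \<subseteq> carrier G" using S'G by auto
    then have eq: "bs_act m p (foldr (mult G) (s # xs) \<one>\<^bsub>G\<^esub>) = bs_act m (bs_act m p s) (foldr (mult G) xs \<one>\<^bsub>G\<^esub>)"
      using S'G by (auto simp: bs_act_mult foldr_mult_closed)
    have "set xs \<subseteq> S'" using Cons.prems by simp
    from near_trans[OF Cons.IH[OF this] c[OF \<open>s \<in> S'\<close>]] show ?case unfolding eq by simp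
  qed
  have "near m (c * N) (coord m X) (coord m Y)"
    if X: "X \<in> carrier G" and Y: "Y \<in> carrier G" and "word_length G S (inv\<^bsub>G\<^esub> X \<otimes>\<^bsub>G\<^esub> Y) \<le> N" for X Y N
  proof -
    have "inv\<^bsub>G\<^esub> X \<otimes>\<^bsub>G\<^esub> Y \<in> carrier G" using X Y by simp
    from word_length_witness[OF S this] obtain xs where xs:
      "length xs = word_length G S (inv\<^bsub>G\<^esub> X \<otimes>\<^bsub>G\<^esub> Y)" "set xs \<subseteq> S'" "foldr (mult G) xs \<one>\<^bsub>G\<^esub> = inv\<^bsub>G\<^esub> X \<otimes>\<^bsub>G\<^esub> Y"
      unfolding S'_def by blast
    have "bs_act m (coord m X) (inv\<^bsub>G\<^esub> X \<otimes>\<^bsub>G\<^esub> Y) = coord m Y"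
      using X Y coord_mult[of X "inv\<^bsub>G\<^esub> X \<otimes>\<^bsub>G\<^esub> Y"] by (simp add: m_assoc[symmetric])
    then have "near m (c * length xs) (coord m X) (coord m Y)"
      using path[OF xs(2), of "coord m X"] xs(3) by simp
    then show ?thesis by (rule near_mono) (use xs(1) that(3) in simp)
  qed
  then show ?thesis by blast
qed

end

section \<open>Quasiisometric embeddings\<close>

definition height_rescale :: "nat \<Rightarrow> nat \<Rightarrow> pt \<Rightarrow> pt" where
  "height_rescale s t p = (fst p, (snd p * int s) div int t)"

lemma powi_power: "real (r ^ s) powi k = real r powi (k * int s)"
  by (simp add: power_int_mult mult.commute[of k] power_int_of_nat)

text \<open>Inverting \<open>r ^ s\<close> is the same as inverting \<open>r\<close>.\<close>

lemma bs_points_power: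
  assumes "r > 0" "s > 0"
  shows "bs_points (r ^ s) = bs_points r"
proof -
  have "(\<exists>b. x \<in> scaled_ints (r ^ s) b) \<longleftrightarrow> (\<exists>b. x \<in> scaled_ints r b)" for x
  proof
    assume "\<exists>b. x \<in> scaled_ints (r ^ s) b"
    then show "\<exists>b. x \<in> scaled_ints r b" unfolding scaled_ints_def powi_power by blast
  next
    assume "\<exists>b. x \<in> scaled_ints r b"
    then obtain b where "x \<in> scaled_ints r b" by blast
    moreover have "- \<bar>b\<bar> * int s \<le> b"
    proof -
      have "\<bar>b\<bar> * 1 \<le> \<bar>b\<bar> * int s" using assms(2) by (intro mult_left_mono) auto
      then show ?thesis by linarith
    qed
    ultimately have "x \<in> scaled_ints r (- \<bar>b\<bar> * int s)" using assms(1) scaled_ints_monoD by blast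
    then have "x \<in> scaled_ints (r ^ s) (- \<bar>b\<bar>)" unfolding scaled_ints_def powi_power .
    then show "\<exists>b. x \<in> scaled_ints (r ^ s) b" by blast
  qed
  then show ?thesis by (simp add: bs_points_def)
qed

text \<open>Write \<open>k * int s = l * int t + int d\<close> with \<open>d < t\<close>: a
  horizontal edge becomes \<open>r ^ d\<close> edges at height \<open>l\<close>. A vertical edge
  changes the rescaled height by at most \<open>s\<close>.\<close>

lemma height_rescale_step:
  assumes r: "r > 0" and s: "s > 0" and t: "t > 0" and pq: "bs_step (r ^ s) p q"
  shows "near (r ^ t) (r ^ t + s) (height_rescale s t p) (height_rescale s t q)"
proof -
  have horiz: "near (r ^ t) (r ^ t) (x, k * int s div int t) (x + e * real (r ^ s) powi k, k * int s div int t)"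
    if "e = 1 \<or> e = -1" for x k and e :: real
  proof -
    define l d where "l = k * int s div int t" and "d = nat (k * int s mod int t)"
    have d: "int d = k * int s mod int t" "d < t" using t by (auto simp: d_def nat_less_iff)
    have ks: "k * int s = l * int t + int d" unfolding d(1) l_def by simp
    have "real (r ^ s) powi k = real r ^ d * real r powi (l * int t)"
      unfolding powi_power ks by (rule powi_add_nat[OF r])
    also have "\<dots> = real (r ^ d) * real (r ^ t) powi l" by (simp only: powi_power) simp
    finally have eq: "real (r ^ s) powi k = real (r ^ d) * real (r ^ t) powi l" .
    have "near (r ^ t) (r ^ d) (x, l) (x + e * real (r ^ s) powi k, l)"
      using near_horizontal_int[of "r ^ t" "int (r ^ d)" x l] near_horizontal_int[of "r ^ t" "- int (r ^ d)" x l] that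
      unfolding eq by (auto simp: nat_power_eq)
    moreover have "r ^ d \<le> r ^ t" using r d(2) by (intro power_increasing) auto
    ultimately show ?thesis unfolding l_def[symmetric] by (rule near_mono)
  qed
  have vert: "near (r ^ t) s (x, k * int s div int t) (x, (k + 1) * int s div int t)" for x k
  proof -
    have le: "k * int s div int t \<le> (k + 1) * int s div int t"
      using t by (intro zdiv_mono1) (auto simp: algebra_simps)
    have "(k + 1) * int s \<le> k * int s + int s * int t"
    proof -
      have "int s * 1 \<le> int s * int t" using t by (intro mult_left_mono) auto
      then show ?thesis by (simp add: algebra_simps)
    qed
    then have "(k + 1) * int s div int t \<le> (k * int s + int s * int t) div int t"
      using t by (intro zdiv_mono1) auto
    also have "\<dots> = k * int s div int t + int s" using t by simp
    finally show ?thesis by (intro near_mono[OF near_vertical_le[OF le]]) simp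
  qed
  have "near (r ^ t) (r ^ t) (height_rescale s t p) (height_rescale s t q) \<or>
    near (r ^ t) s (height_rescale s t p) (height_rescale s t q)"
    using pq
  proof cases
    case (right x k) then show ?thesis using horiz[of 1 x k] by (simp add: height_rescale_def)
  next
    case (left x k) then show ?thesis using horiz[of "-1" x k] by (simp add: height_rescale_def)
  next
    case (up x k) then show ?thesis using vert[of x k] by (simp add: height_rescale_def)
  next
    case (down x k) then show ?thesis using near_sym[OF vert[of x "k - 1"]] by (simp add: height_rescale_def)
  qed
  then show ?thesis by (auto intro: near_mono)
qed

lemma height_rescale_near:
  assumes "r > 0" "s > 0" "t > 0"
  shows "near (r ^ s) N p q \<Longrightarrow> near (r ^ t) ((r ^ t + s) * N) (height_rescale s t p) (height_rescale s t q)"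
proof (induction rule: near.induct)
  case (step N p q w)
  from near_trans[OF height_rescale_step[OF assms step.hyps(2)] step.IH] show ?case by (simp add: algebra_simps)
qed (rule near.refl)

text \<open>The two roundings lower the height by at most \<open>t\<close> and leave the real
  coordinate fixed.\<close>

lemma height_rescale_back:
  assumes s: "s > 0" and t: "t > 0"
  shows "near m t (height_rescale t s (height_rescale s t p)) p"
proof -
  define k l where "k = snd p" and "l = k * int s div int t"
  have "l * int t \<le> k * int s" "k * int s - int t < l * int t"
    using t pos_mod_bound[of "int t" "k * int s"] pos_mod_sign[of "int t" "k * int s"]
      div_mult_mod_eq[of "k * int s" "int t"] unfolding l_def by linarith+
  moreover have "(k - int t) * int s \<le> k * int s - int t"
  proof -
    have "int t * 1 \<le> int t * int s" using s by (intro mult_left_mono) auto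
    then show ?thesis by (simp add: algebra_simps)
  qed
  ultimately have ineq: "(k - int t) * int s \<le> l * int t" "l * int t \<le> k * int s" by linarith+
  have "(k - int t) * int s div int s \<le> l * int t div int s" "l * int t div int s \<le> k * int s div int s"
    using s zdiv_mono1[OF ineq(1), of "int s"] zdiv_mono1[OF ineq(2), of "int s"] by (simp_all only: of_nat_0_less_iff)
  moreover have "(k - int t) * int s div int s = k - int t" "k * int s div int s = k" using s by simp_all
  ultimately have "k - int t \<le> l * int t div int s" "l * int t div int s \<le> k" by (simp_all only:)
  then have "near m t (fst p, l * int t div int s) (fst p, k)"
    by (intro near_mono[OF near_vertical_le]) auto
  then show ?thesis by (simp add: height_rescale_def k_def l_def)
qed

text \<open>The upper bound is the Lipschitz property of \<open>height_rescale\<close>. The lower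
  bound follows by rescaling back, with additive error \<open>t\<close> at each of the two
  points.\<close>

lemma quasiisometric_embedding_of_powers:
  assumes r: "r > 0" and s: "s > 0" and t: "t > 0"
    and S: "finite_generating_set (BS (r ^ s)) S" and T: "finite_generating_set (BS (r ^ t)) T"
  shows "\<exists>f. quasiisometric_embedding (carrier (BS (r ^ s))) (word_dist (BS (r ^ s)) S)
    (carrier (BS (r ^ t))) (word_dist (BS (r ^ t)) T) f"
proof -
  define m n where "m = r ^ s" and "n = r ^ t"
  interpret M: bs_group m using r by unfold_locales (simp add: m_def)
  interpret N: bs_group n using r by unfold_locales (simp add: n_def)
  obtain c1 where c1: "\<And>X Y N. X \<in> carrier (BS m) \<Longrightarrow> Y \<in> carrier (BS m) \<Longrightarrow>
      near m N (coord m X) (coord m Y) \<Longrightarrow> word_length (BS m) S (inv\<^bsub>BS m\<^esub> X \<otimes>\<^bsub>BS m\<^esub> Y) \<le> c1 * N"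
    using M.word_length_le_near S unfolding m_def by blast
  obtain c2 where c2: "\<And>X Y N. X \<in> carrier (BS m) \<Longrightarrow> Y \<in> carrier (BS m) \<Longrightarrow>
      word_length (BS m) S (inv\<^bsub>BS m\<^esub> X \<otimes>\<^bsub>BS m\<^esub> Y) \<le> N \<Longrightarrow> near m (c2 * N) (coord m X) (coord m Y)"
    using M.near_word_length S unfolding m_def by blast
  obtain c3 where c3: "\<And>X Y N. X \<in> carrier (BS n) \<Longrightarrow> Y \<in> carrier (BS n) \<Longrightarrow>
      near n N (coord n X) (coord n Y) \<Longrightarrow> word_length (BS n) T (inv\<^bsub>BS n\<^esub> X \<otimes>\<^bsub>BS n\<^esub> Y) \<le> c3 * N"
    using N.word_length_le_near T unfolding n_def by blast
  obtain c4 where c4: "\<And>X Y N. X \<in> carrier (BS n) \<Longrightarrow> Y \<in> carrier (BS n) \<Longrightarrow>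
      word_length (BS n) T (inv\<^bsub>BS n\<^esub> X \<otimes>\<^bsub>BS n\<^esub> Y) \<le> N \<Longrightarrow> near n (c4 * N) (coord n X) (coord n Y)"
    using N.near_word_length T unfolding n_def by blast
  define f where "f X = inv_into (carrier (BS n)) (coord n) (height_rescale s t (coord m X))" for X
  have f: "f X \<in> carrier (BS n) \<and> coord n (f X) = height_rescale s t (coord m X)" if "X \<in> carrier (BS m)" for X
  proof -
    have "coord m X \<in> bs_points r"
      using that M.coord_image bs_points_power[OF r s] unfolding m_def by blast
    then have "height_rescale s t (coord m X) \<in> bs_points n"
      using bs_points_power[OF r t] unfolding n_def by (simp add: height_rescale_def bs_points_def)
    then have "height_rescale s t (coord m X) \<in> coord n ` carrier (BS n)" by (simp add: N.coord_image)
    then show ?thesis unfolding f_def by (simp add: inv_into_into f_inv_into_f)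
  qed
  define A where "A = c3 * ((r ^ t + s) * c2)"
  define B where "B = c1 * ((r ^ s + t) * c4)"
  define C where "C = c1 * (2 * t)"
  have up: "word_length (BS n) T (inv\<^bsub>BS n\<^esub> f X \<otimes>\<^bsub>BS n\<^esub> f Y) \<le> A * word_length (BS m) S (inv\<^bsub>BS m\<^esub> X \<otimes>\<^bsub>BS m\<^esub> Y)"
    if XY: "X \<in> carrier (BS m)" "Y \<in> carrier (BS m)" for X Y
  proof -
    have "near n ((r ^ t + s) * (c2 * word_length (BS m) S (inv\<^bsub>BS m\<^esub> X \<otimes>\<^bsub>BS m\<^esub> Y))) (coord n (f X)) (coord n (f Y))"
      using height_rescale_near[OF r s t] c2[OF XY order_refl] f XY unfolding m_def n_def by simp
    from c3[OF _ _ this] show ?thesis using f XY by (simp add: A_def mult.assoc)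
  qed
  have low: "word_length (BS m) S (inv\<^bsub>BS m\<^esub> X \<otimes>\<^bsub>BS m\<^esub> Y) \<le> B * word_length (BS n) T (inv\<^bsub>BS n\<^esub> f X \<otimes>\<^bsub>BS n\<^esub> f Y) + C"
    if XY: "X \<in> carrier (BS m)" "Y \<in> carrier (BS m)" for X Y
  proof -
    let ?N = "(r ^ s + t) * (c4 * word_length (BS n) T (inv\<^bsub>BS n\<^esub> f X \<otimes>\<^bsub>BS n\<^esub> f Y))"
    have "near n (c4 * word_length (BS n) T (inv\<^bsub>BS n\<^esub> f X \<otimes>\<^bsub>BS n\<^esub> f Y)) (height_rescale s t (coord m X)) (height_rescale s t (coord m Y))"
      using c4[OF _ _ order_refl, of "f X" "f Y"] f XY by simp
    then have "near m ?N (height_rescale t s (height_rescale s t (coord m X))) (height_rescale t s (height_rescale s t (coord m Y)))"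
      unfolding m_def n_def by (rule height_rescale_near[OF r t s])
    from near_trans[OF near_trans[OF height_rescale_back[OF s t] this] near_sym[OF height_rescale_back[OF s t]]]
    have "near m (?N + 2 * t) (coord m X) (coord m Y)" by (rule near_mono) simp
    from c1[OF XY this] show ?thesis by (simp add: B_def C_def algebra_simps)
  qed
  define K where "K = real A + real B + 1"
  have K: "K \<ge> 1" by (simp add: K_def)
  have "\<forall>X\<in>carrier (BS m). \<forall>Y\<in>carrier (BS m).
      1 / K * word_dist (BS m) S X Y - real C \<le> word_dist (BS n) T (f X) (f Y) \<and>
      word_dist (BS n) T (f X) (f Y) \<le> K * word_dist (BS m) S X Y + real C"
  proof (intro conjI ballI)
    fix X Y assume XY: "X \<in> carrier (BS m)" "Y \<in> carrier (BS m)"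
    define dX dY where "dX = word_dist (BS m) S X Y" and "dY = word_dist (BS n) T (f X) (f Y)"
    have d: "dX = real (word_length (BS m) S (inv\<^bsub>BS m\<^esub> X \<otimes>\<^bsub>BS m\<^esub> Y))"
      "dY = real (word_length (BS n) T (inv\<^bsub>BS n\<^esub> f X \<otimes>\<^bsub>BS n\<^esub> f Y))"
      using XY f by (simp_all add: dX_def dY_def word_dist_def)
    have "dX \<le> real B * dY + real C" using low[OF XY] unfolding d by (simp flip: of_nat_mult of_nat_add)
    also have "real B * dY \<le> K * dY" by (intro mult_right_mono) (auto simp: K_def d)
    also have "real C \<le> K * real C" using mult_right_mono[OF K, of "real C"] by simp
    finally show "1 / K * word_dist (BS m) S X Y - real C \<le> word_dist (BS n) T (f X) (f Y)"
      unfolding dX_def[symmetric] dY_def[symmetric] using K by (simp add: field_simps)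
    have "dY \<le> real A * dX" using up[OF XY] unfolding d by (simp flip: of_nat_mult)
    also have "\<dots> \<le> K * dX + real C" unfolding K_def d by (simp add: algebra_simps)
    finally show "word_dist (BS n) T (f X) (f Y) \<le> K * word_dist (BS m) S X Y + real C"
      by (simp only: dX_def dY_def)
  qed
  moreover have "f ` carrier (BS m) \<subseteq> carrier (BS n)" using f by blast
  ultimately have "quasiisometric_embedding (carrier (BS m)) (word_dist (BS m) S)
      (carrier (BS n)) (word_dist (BS n) T) f"
    unfolding quasiisometric_embedding_def using K of_nat_0_le_iff[of C, where 'a = real] by blast
  then show ?thesis unfolding m_def n_def by blast
qed

lemma powers_of_quasiisometric_embedding:
  assumes m: "m \<ge> 2" and n: "n \<ge> 2"
    and S: "finite_generating_set (BS m) S" and T: "finite_generating_set (BS n) T"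
    and f: "quasiisometric_embedding (carrier (BS m)) (word_dist (BS m) S)
      (carrier (BS n)) (word_dist (BS n) T) f"
  shows "powers_of_common_integer m n"
proof -
  interpret M: bs_group m using m by unfold_locales simp
  interpret N: bs_group n using n by unfold_locales simp
  obtain c1 where c1: "\<And>X Y N. X \<in> carrier (BS m) \<Longrightarrow> Y \<in> carrier (BS m) \<Longrightarrow>
      near m N (coord m X) (coord m Y) \<Longrightarrow> word_length (BS m) S (inv\<^bsub>BS m\<^esub> X \<otimes>\<^bsub>BS m\<^esub> Y) \<le> c1 * N"
    using M.word_length_le_near S by blast
  obtain c2 where c2: "\<And>X Y N. X \<in> carrier (BS m) \<Longrightarrow> Y \<in> carrier (BS m) \<Longrightarrow>
      word_length (BS m) S (inv\<^bsub>BS m\<^esub> X \<otimes>\<^bsub>BS m\<^esub> Y) \<le> N \<Longrightarrow> near m (c2 * N) (coord m X) (coord m Y)"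
    using M.near_word_length S by blast
  obtain c3 where c3: "\<And>X Y N. X \<in> carrier (BS n) \<Longrightarrow> Y \<in> carrier (BS n) \<Longrightarrow>
      near n N (coord n X) (coord n Y) \<Longrightarrow> word_length (BS n) T (inv\<^bsub>BS n\<^esub> X \<otimes>\<^bsub>BS n\<^esub> Y) \<le> c3 * N"
    using N.word_length_le_near T by blast
  obtain c4 where c4: "\<And>X Y N. X \<in> carrier (BS n) \<Longrightarrow> Y \<in> carrier (BS n) \<Longrightarrow>
      word_length (BS n) T (inv\<^bsub>BS n\<^esub> X \<otimes>\<^bsub>BS n\<^esub> Y) \<le> N \<Longrightarrow> near n (c4 * N) (coord n X) (coord n Y)"
    using N.near_word_length T by blast
  obtain K C where K: "K \<ge> 1" and fc: "f ` carrier (BS m) \<subseteq> carrier (BS n)"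
    and KC: "\<And>X Y. X \<in> carrier (BS m) \<Longrightarrow> Y \<in> carrier (BS m) \<Longrightarrow>
      1 / K * word_dist (BS m) S X Y - C \<le> word_dist (BS n) T (f X) (f Y) \<and>
      word_dist (BS n) T (f X) (f Y) \<le> K * word_dist (BS m) S X Y + C"
    using f unfolding quasiisometric_embedding_def by blast
  define g where "g p = inv_into (carrier (BS m)) (coord m) p" for p
  have g: "g p \<in> carrier (BS m)" "coord m (g p) = p" if "p \<in> bs_points m" for p
    using that by (simp_all add: g_def inv_into_into f_inv_into_f flip: M.coord_image)
  define F where "F p = coord n (f (g p))" for p
  \<comment> \<open>\<open>L\<close> comes from the upper quasiisometry bound for adjacent points
    and \<rho> from the lower bound, each translated between word lengths and paths.\<close>
  define L where "L = c4 * nat \<lceil>K * real c1 + C\<rceil>"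
  define \<rho> where "\<rho> N = c2 * nat \<lceil>K * (real (c3 * N) + C)\<rceil>" for N
  have dist: "word_dist (BS m) S X Y = real (word_length (BS m) S (inv\<^bsub>BS m\<^esub> X \<otimes>\<^bsub>BS m\<^esub> Y))"
      "word_dist (BS n) T (f X) (f Y) = real (word_length (BS n) T (inv\<^bsub>BS n\<^esub> f X \<otimes>\<^bsub>BS n\<^esub> f Y))"
    if "X \<in> carrier (BS m)" "Y \<in> carrier (BS m)" for X Y
    using that fc by (auto simp: word_dist_def)
  interpret bs_coarse_embedding m n L \<rho> F
  proof
    fix p q assume p: "p \<in> bs_points m" and pq: "bs_step m p q"
    have q: "q \<in> bs_points m" using bs_step_bs_points[OF M.m0 pq p] .
    have "near m 1 (coord m (g p)) (coord m (g q))" using near_1[OF pq] g(2) p q by simp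
    from c1[OF g(1)[OF p] g(1)[OF q] this]
    have "word_dist (BS m) S (g p) (g q) \<le> real c1" using dist g(1) p q by simp
    then have "K * word_dist (BS m) S (g p) (g q) \<le> K * real c1" using K by simp
    with KC[OF g(1)[OF p] g(1)[OF q]]
    have "real (word_length (BS n) T (inv\<^bsub>BS n\<^esub> f (g p) \<otimes>\<^bsub>BS n\<^esub> f (g q))) \<le> K * real c1 + C"
      using dist(2)[OF g(1)[OF p] g(1)[OF q]] by linarith
    then have "word_length (BS n) T (inv\<^bsub>BS n\<^esub> f (g p) \<otimes>\<^bsub>BS n\<^esub> f (g q)) \<le> nat \<lceil>K * real c1 + C\<rceil>"
      by linarith
    from c4[OF _ _ this] show "near n L (F p) (F q)"
      unfolding F_def L_def using fc g(1) p q by blast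
  next
    fix p q N assume p: "p \<in> bs_points m" and q: "q \<in> bs_points m" and "near n N (F p) (F q)"
    then have "word_length (BS n) T (inv\<^bsub>BS n\<^esub> f (g p) \<otimes>\<^bsub>BS n\<^esub> f (g q)) \<le> c3 * N"
      unfolding F_def using c3 fc g(1) by blast
    then have "word_dist (BS n) T (f (g p)) (f (g q)) \<le> real (c3 * N)"
      unfolding dist(2)[OF g(1)[OF p] g(1)[OF q]] by (rule of_nat_mono)
    with KC[OF g(1)[OF p] g(1)[OF q]]
    have "1 / K * word_dist (BS m) S (g p) (g q) \<le> real (c3 * N) + C" by linarith
    then have "word_dist (BS m) S (g p) (g q) \<le> K * (real (c3 * N) + C)"
      using K by (simp add: field_simps)
    then have "word_length (BS m) S (inv\<^bsub>BS m\<^esub> g p \<otimes>\<^bsub>BS m\<^esub> g q) \<le> nat \<lceil>K * (real (c3 * N) + C)\<rceil>"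
      unfolding dist(1)[OF g(1)[OF p] g(1)[OF q]] by linarith
    from c2[OF g(1)[OF p] g(1)[OF q] this] show "near m (\<rho> N) p q"
      unfolding \<rho>_def using g(2) p q by simp
  qed (use m n in auto)
  show ?thesis by (rule source_target_common_power)
qed

theorem corollary4:
  fixes m n :: nat
    and S T :: "bs_gen word set set"
  assumes "m \<ge> 2" and "n \<ge> 2"
    and "finite_generating_set (BS m) S" and "finite_generating_set (BS n) T"
  shows "(\<exists>f. quasiisometric_embedding (carrier (BS m)) (word_dist (BS m) S)
                (carrier (BS n)) (word_dist (BS n) T) f)
         \<longleftrightarrow> powers_of_common_integer m n"
proof
  assume "powers_of_common_integer m n"
  then show "\<exists>f. quasiisometric_embedding (carrier (BS m)) (word_dist (BS m) S)
                (carrier (BS n)) (word_dist (BS n) T) f"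
    using quasiisometric_embedding_of_powers assms(3,4) unfolding powers_of_common_integer_def by metis
qed (use powers_of_quasiisometric_embedding assms in blast)

end
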